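(* (a) The polynomials $x^4+1$ and $x^4+2$ are $2$-superirreducible over $\mathbb{Q}$. (b) Every polynomial in the following sets that is irreducible over $\mathbb{Q}$ is $2$-superirreducible over $\mathbb{Q}$: (i) $x^4+p$ with $p$ prime and $p\equiv 7,11 \pmod{16}$; (ii) $x^4+2p$ with $p$ prime and $p\equiv \pm 3\pmod 8$; (iii) $x^4+4p$ and $x^4-p$ with $p$ prime and $p\equiv \pm 3, -5\pmod{16}$.
   Context: For a commutative integral domain $I$ and $k\in\mathbb{N}$, a polynomial $f\in I[x]$ is called $k$-superirreducible over $I$ if $f$ is irreducible in $I[x]$ and, for every non-constant polynomial $g\in I[x]$ of degree at most $k$, the composition $f(g(x))$ is irreducible in $I[x]$. *)

theory Defs
  imports Complex_Main "HOL-Computational_Algebra.Computational_Algebra" "HOL-Number_Theory.Cong"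
begin

definition superirreducible :: "nat \<Rightarrow> 'a::idom poly \<Rightarrow> bool" where
  "superirreducible k f \<longleftrightarrow>
     irreducible f \<and>
     (\<forall>g. 0 < degree g \<and> degree g \<le> k \<longrightarrow> irreducible (f \<circ>\<^sub>p g))"

definition quartic :: "int \<Rightarrow> rat poly" where
  "quartic c = monom 1 4 + [:of_int c:]"

end

theory Submission
  imports Defs "HOL-Computational_Algebra.Field_as_Ring"
begin

text \<open>
  For \<open>f = x\<^sup>4 + c\<close> irreducible and \<open>g\<close> quadratic, complete the square in \<open>g\<close> and compare an
  irreducible factor \<open>A(x)\<close> of \<open>f(a x\<^sup>2 + b)\<close> with \<open>A(-x)\<close>: if \<open>f(g(x))\<close> is reducible, then
  \<open>f = E\<^sup>2 - e (t - b) H\<^sup>2\<close> with \<open>e \<noteq> 0\<close>, \<open>E\<close> monic quadratic and \<open>H\<close> of degree at most \<open>1\<close>.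
  Comparing coefficients and eliminating shows that \<open>r\<^sup>4 + c\<close> is a rational square, where \<open>-r\<close> is the
  root of \<open>H\<close> and is nonzero. So it suffices that \<open>X\<^sup>4 + c Z\<^sup>4 = Y\<^sup>2\<close> has no integer solution with
  \<open>X Z \<noteq> 0\<close>. For each \<open>c\<close> this follows by Fermat descent: \<open>Y\<^sup>2 - X\<^sup>4\<close> splits into two nearly coprime
  factors with product \<open>c Z\<^sup>4\<close>, so both are fourth powers up to divisors of \<open>4 c\<close>; congruences
  modulo 16 rule out all but one distribution, and that one, split once more, gives a smaller
  solution. The case \<open>c = - p\<close> reduces to \<open>c = 4 p\<close> by the same splitting.
\<close>

section \<open>Coprime splittings and residues modulo 16\<close>

text \<open>As \<open>U\<close> and \<open>V\<close> are coprime, every divisor \<open>m\<close> of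
  \<open>U * V\<close> equals \<open>gcd m U * gcd m V\<close>; this splits both \<open>w\<close>
  and \<open>k\<close>. Then \<open>U\<close> and \<open>k1 * a ^ n\<close> divide each other, each
  being coprime to the opposite factor.\<close>

lemma coprime_mult_eq_mult_power:
  fixes U V k w n :: nat
  assumes cop: "coprime U V" and eq: "U * V = k * w ^ n" and "n > 0" "k > 0" "w > 0"
  obtains k1 k2 a b where "k = k1 * k2" "w = a * b" "U = k1 * a ^ n" "V = k2 * b ^ n"
proof -
  define a b k1 k2 where "a = gcd w U" "b = gcd w V" "k1 = gcd k U" "k2 = gcd k V"
  note d = this
  have g: "gcd m U * gcd m V = m" if "m dvd U * V" for m
    using that cop by (smt (verit, best) coprime_commute coprime_divisors
      coprime_dvd_mult_left_iff dvd_productE dvd_triv_left gcd.commute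
      gcd_mult_right_left_cancel gcd_mult_right_right_cancel gcd_nat.absorb_iff2)
  have w: "w = a * b" using g[of w] eq \<open>n > 0\<close> by (simp add: d dvd_power)
  have k: "k = k1 * k2" using g[of k] eq by (simp add: d)
  have UV: "U * V = (k1 * a ^ n) * (k2 * b ^ n)"
    by (simp add: eq) (simp add: w k power_mult_distrib)
  have pos: "U > 0" "V > 0" using eq \<open>k > 0\<close> \<open>w > 0\<close> by (auto intro!: gr0I)
  have c1: "coprime U (k2 * b ^ n)"
    using cop unfolding d by (auto intro: coprime_divisors[of U U _ V])
  have c2: "coprime V (k1 * a ^ n)"
    using cop unfolding d by (auto simp: coprime_commute intro: coprime_divisors[of V V _ U])
  have "U dvd k1 * a ^ n"
    by (metis UV c1 coprime_dvd_mult_left_iff dvd_triv_left)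
  moreover have "k1 * a ^ n dvd U"
    by (metis UV c2 coprime_commute coprime_dvd_mult_left_iff dvd_triv_left)
  ultimately have U: "U = k1 * a ^ n" by (simp add: dvd_antisym)
  with UV pos have "V = k2 * b ^ n" by auto
  with U w k that show ?thesis by blast
qed

text \<open>\<open>Y + X\<close> and \<open>Y - X\<close> have an odd product, and a common divisor
  would divide both \<open>2 * X\<close> and \<open>2 * Y\<close>, so they are coprime.\<close>

lemma diff_squares_split_odd:
  fixes X Y k w :: nat
  assumes eq: "Y\<^sup>2 = X\<^sup>2 + k * w ^ 4" and cop: "coprime X Y" and odd: "odd (k * w ^ 4)"
  obtains k1 k2 a b where "k = k1 * k2" "w = a * b" "coprime (k1 * a ^ 4) (k2 * b ^ 4)"
    "2 * Y = k1 * a ^ 4 + k2 * b ^ 4" "2 * X + k2 * b ^ 4 = k1 * a ^ 4"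
proof -
  have "X\<^sup>2 \<le> Y\<^sup>2" using eq by simp
  then have "X \<le> Y" by (simp add: power2_nat_le_eq_le)
  then obtain D where D: "Y = X + D" using le_Suc_ex by blast
  have p: "(2 * X + D) * D = k * w ^ 4"
    using eq by (simp add: D power2_eq_square algebra_simps)
  with odd have "odd D" by (metis even_mult_iff)
  have "coprime X D" using cop by (simp add: D coprime_iff_gcd_eq_1)
  then have "coprime (2 * X) D" using \<open>odd D\<close> by simp
  then have c: "coprime (2 * X + D) D" by (simp only: coprime_iff_gcd_eq_1 gcd_add1)
  have "k > 0" "w > 0" using odd by (auto intro!: gr0I)
  then obtain k1 k2 a b where s: "k = k1 * k2" "w = a * b" "2 * X + D = k1 * a ^ 4" "D = k2 * b ^ 4"
    using coprime_mult_eq_mult_power[OF c p zero_less_numeral] by blast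
  show ?thesis
    by (rule that[of k1 k2 a b]) (use s c D in auto)
qed

text \<open>For odd \<open>X\<close> and \<open>Y\<close> it is the halves of \<open>Y + X\<close>
  and \<open>Y - X\<close> that are coprime; the factor 4 pays for the halving.\<close>

lemma diff_squares_split_even:
  fixes X Y k w :: nat
  assumes eq: "Y\<^sup>2 = X\<^sup>2 + 4 * k * w ^ 4" and cop: "coprime X Y" and odd: "odd X" "odd Y"
    and pos: "k > 0" "w > 0"
  obtains k1 k2 a b where "k = k1 * k2" "w = a * b" "coprime (k1 * a ^ 4) (k2 * b ^ 4)"
    "Y = k1 * a ^ 4 + k2 * b ^ 4" "X + k2 * b ^ 4 = k1 * a ^ 4"
proof -
  have "X\<^sup>2 \<le> Y\<^sup>2" using eq by simp
  then have "X \<le> Y" by (simp add: power2_nat_le_eq_le)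
  then obtain D where D: "Y = X + D" using le_Suc_ex by blast
  with odd obtain D' where D': "D = 2 * D'" by fastforce
  have p: "(X + D') * D' = k * w ^ 4"
    using eq by (simp add: D D' power2_eq_square algebra_simps)
  have "coprime X (2 * D')" using cop unfolding D D' coprime_iff_gcd_eq_1 by (simp only: gcd_add2)
  then have "coprime X D'" by simp
  then have c: "coprime (X + D') D'" by (simp only: coprime_iff_gcd_eq_1 gcd_add1)
  then obtain k1 k2 a b where s: "k = k1 * k2" "w = a * b" "X + D' = k1 * a ^ 4" "D' = k2 * b ^ 4"
    using coprime_mult_eq_mult_power[OF c p zero_less_numeral pos] by blast
  show ?thesis
    by (rule that[of k1 k2 a b]) (use s c D D' in auto)
qed

section \<open>Squares and fourth powers modulo 16\<close>

lemma odd_power4_mod_16: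
  fixes n :: nat
  assumes "odd n"
  shows "n ^ 4 mod 16 = 1"
proof -
  have "n mod 16 \<in> {1,3,5,7,9,11,13,15}" using assms by simp presburger
  then have "(n mod 16) ^ 4 mod 16 = 1" by auto
  then show ?thesis by (simp add: power_mod)
qed

text \<open>An odd fourth power is 1 modulo 16 and keeps the residue of \<open>k\<close>; an even
  one is 0 and erases it.\<close>

lemma mult_power4_mod_16:
  fixes n k :: nat
  assumes "k mod 16 \<in> S" "odd n \<or> 0 \<in> S"
  shows "(k * n ^ 4) mod 16 \<in> S"
proof (cases "even n")
  case True
  then have "(k * n ^ 4) mod 16 = 0" by (auto elim!: evenE simp: power_mult_distrib)
  with True assms show ?thesis by simp
next
  case False
  then have "(k * n ^ 4) mod 16 = k mod 16"
    using mod_mult_cong[of k 16 k "n ^ 4" 1] by (simp add: odd_power4_mod_16)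
  with assms show ?thesis by simp
qed

lemma square_mod_16:
  fixes n :: nat
  shows "n\<^sup>2 mod 16 \<in> {0,1,4,9}"
proof -
  have "n mod 16 \<in> {0,1,2,3,4,5,6,7,8,9,10,11,12,13,14,15}" by simp presburger
  then have "(n mod 16)\<^sup>2 mod 16 \<in> {0,1,4,9}" by auto
  then show ?thesis by (simp add: power_mod)
qed

text \<open>The sets collect the residues that the coefficients may take; a residue \<open>0\<close> has to be
  included whenever the base of the fourth power may be even.\<close>

lemma square_plus_quartic_neq:
  fixes m n k1 k2 a b :: nat
  assumes "k2 mod 16 \<in> S2" "odd b \<or> 0 \<in> S2" "k1 mod 16 \<in> S1" "odd a \<or> 0 \<in> S1"
    and neq: "\<forall>s\<in>{0,1,4,9}. \<forall>\<beta>\<in>S2. \<forall>\<alpha>\<in>S1. (m * s + \<beta>) mod 16 \<noteq> \<alpha>"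
  shows "m * n\<^sup>2 + k2 * b ^ 4 \<noteq> k1 * a ^ 4"
proof
  assume eq: "m * n\<^sup>2 + k2 * b ^ 4 = k1 * a ^ 4"
  have "(m * (n\<^sup>2 mod 16) + (k2 * b ^ 4) mod 16) mod 16 = (m * n\<^sup>2 + k2 * b ^ 4) mod 16"
    by (rule mod_add_cong) (simp_all add: mod_mult_right_eq)
  then show False
    using neq[THEN bspec, OF square_mod_16[of n], THEN bspec, OF mult_power4_mod_16[OF assms(1,2)],
        THEN bspec, OF mult_power4_mod_16[OF assms(3,4)]]
    unfolding eq by contradiction
qed

lemma square_neq_quartic:
  fixes m n k1 k2 a b :: nat
  assumes "k1 mod 16 \<in> S1" "odd a \<or> 0 \<in> S1" "k2 mod 16 \<in> S2" "odd b \<or> 0 \<in> S2"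
    and neq: "\<forall>s\<in>{0,1,4,9}. \<forall>\<alpha>\<in>S1. \<forall>\<beta>\<in>S2. (m * s) mod 16 \<noteq> (\<alpha> + \<beta>) mod 16"
  shows "m * n\<^sup>2 \<noteq> k1 * a ^ 4 + k2 * b ^ 4"
proof
  assume eq: "m * n\<^sup>2 = k1 * a ^ 4 + k2 * b ^ 4"
  have "((k1 * a ^ 4) mod 16 + (k2 * b ^ 4) mod 16) mod 16 = (k1 * a ^ 4 + k2 * b ^ 4) mod 16"
    by (rule mod_add_eq)
  moreover have "(m * (n\<^sup>2 mod 16)) mod 16 = (m * n\<^sup>2) mod 16"
    by (rule mod_mult_right_eq)
  ultimately show False
    using neq[THEN bspec, OF square_mod_16[of n], THEN bspec, OF mult_power4_mod_16[OF assms(1,2)],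
        THEN bspec, OF mult_power4_mod_16[OF assms(3,4)]]
    unfolding eq by argo
qed

lemma coprime_mult_eq_two_power:
  fixes l m :: nat
  assumes "coprime l m" "l * m = 2 ^ j"
  shows "l = 1 \<or> m = 1"
proof -
  obtain i i' where "l = 2 ^ i" "m = 2 ^ i'"
    using assms(2) by (metis divides_primepow_nat dvd_triv_left dvd_triv_right two_is_prime_nat)
  with assms(1) show ?thesis by (cases i; cases i') auto
qed

text \<open>One factor absorbs \<open>p\<close>; its cofactor and the other factor are then coprime
  with product \<open>2 ^ j\<close>, so one of them is 1.\<close>

lemma coprime_mult_eq_two_power_mult_prime:
  fixes p k1 k2 :: nat
  assumes "prime p" "coprime k1 k2" "k1 * k2 = 2 ^ j * p"
  shows "(k1, k2) \<in> {(1, 2 ^ j * p), (2 ^ j * p, 1), (2 ^ j, p), (p, 2 ^ j)}"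
proof -
  have "p > 0" using assms(1) by (simp add: prime_gt_0_nat)
  have "p dvd k1 \<or> p dvd k2" using assms by (metis dvd_triv_right prime_dvd_mult_iff)
  then show ?thesis
  proof
    assume "p dvd k1"
    then obtain l where l: "k1 = l * p" by (metis dvdE mult.commute)
    with assms \<open>p > 0\<close> have "l * k2 = 2 ^ j" "coprime l k2" by (auto simp: algebra_simps)
    with l coprime_mult_eq_two_power[of l k2 j] show ?thesis by auto
  next
    assume "p dvd k2"
    then obtain l where l: "k2 = l * p" by (metis dvdE mult.commute)
    with assms \<open>p > 0\<close> have "k1 * l = 2 ^ j" "coprime k1 l" by (auto simp: algebra_simps)
    with l coprime_mult_eq_two_power[of k1 l j] show ?thesis by auto
  qed
qed

section \<open>Coprimality and the two splittings of a descent step\<close>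

text \<open>For a common prime \<open>q\<close> of \<open>x\<close> and \<open>y\<close>,
  \<open>q^2\<close> divides \<open>c * z ^ 4\<close>, hence \<open>c\<close>, since
  \<open>q\<close> does not divide \<open>z\<close>. The second form of the equation serves negative
  constants.\<close>

lemma coprime_if_no_common_square:
  fixes x y z c :: nat
  assumes cop: "coprime x z" and eq: "y\<^sup>2 = x ^ 4 + c * z ^ 4 \<or> y\<^sup>2 + c * z ^ 4 = x ^ 4"
    and c: "\<And>q. prime q \<Longrightarrow> q dvd x \<Longrightarrow> \<not> q\<^sup>2 dvd c"
  shows "coprime x y"
proof (rule ccontr)
  assume "\<not> coprime x y"
  then obtain q where q: "prime q" "q dvd x" "q dvd y"
    by (metis coprime_iff_gcd_eq_1 gcd_dvd1 gcd_dvd2 prime_factor_nat dvd_trans)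
  have y: "q\<^sup>2 dvd y\<^sup>2" using q(3) by simp
  have "x ^ 4 = x\<^sup>2 * x\<^sup>2" by (simp add: power2_eq_square power4_eq_xxxx)
  with q(2) have x: "q\<^sup>2 dvd x ^ 4" by (metis dvd_mult dvd_power_same)
  from eq have "q\<^sup>2 dvd c * z ^ 4"
  proof
    assume "y\<^sup>2 = x ^ 4 + c * z ^ 4"
    with x y show ?thesis by (metis dvd_add_right_iff)
  next
    assume "y\<^sup>2 + c * z ^ 4 = x ^ 4"
    with x y show ?thesis by (metis dvd_add_right_iff)
  qed
  moreover have "coprime (q\<^sup>2) (z ^ 4)"
    using q(2) cop by (metis coprime_divisors coprime_power_left_iff coprime_power_right_iff dvd_refl)
  ultimately have "q\<^sup>2 dvd c" by (simp add: coprime_dvd_mult_left_iff)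
  with c q show False by blast
qed

lemma prime_not_square_dvd:
  fixes p q :: nat
  assumes "prime p" "prime q"
  shows "\<not> q\<^sup>2 dvd p"
proof
  assume "q\<^sup>2 dvd p"
  moreover from this have "q = p"
    using assms by (metis dvd_mult_left power2_eq_square primes_dvd_imp_eq)
  ultimately have "p\<^sup>2 \<le> p" using prime_gt_0_nat[OF assms(1)] by (simp add: dvd_imp_le)
  with prime_gt_1_nat[OF assms(1)] show False by (simp add: power2_eq_square)
qed

lemma coprime_of_sum:
  fixes X A B :: nat
  assumes "X + B = A" "coprime A B"
  shows "coprime X A"
proof -
  have "coprime X B" using assms by (metis coprime_iff_gcd_eq_1 gcd_add1)
  then show ?thesis using assms(1) by (metis coprime_iff_gcd_eq_1 gcd_add2)
qed

text \<open>First splitting: half the sum and half the difference of \<open>y\<close> and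
  \<open>x^2\<close> are coprime with product \<open>4 * c * w ^ 4\<close>.\<close>

lemma quartic_eq_square_split:
  fixes x y w c :: nat
  assumes eq: "x ^ 4 + c * (2 * w) ^ 4 = y\<^sup>2" and cop: "coprime x y" and "odd x" "c > 0" "w > 0"
  obtains k1 k2 a b where "4 * c = k1 * k2" "w = a * b" "coprime (k1 * a ^ 4) (k2 * b ^ 4)"
    "x\<^sup>2 + k2 * b ^ 4 = k1 * a ^ 4"
proof -
  have "even (c * (2 * w) ^ 4)" by simp
  then have "odd (y\<^sup>2)" using \<open>odd x\<close> by (simp flip: eq)
  then have "odd y" by simp
  have e: "y\<^sup>2 = (x\<^sup>2)\<^sup>2 + 4 * (4 * c) * w ^ 4"
    using eq by (simp add: power_mult_distrib)
  have h: "coprime (x\<^sup>2) y" "odd (x\<^sup>2)" "4 * c > 0" using cop \<open>odd x\<close> \<open>c > 0\<close> by simp_all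
  show thesis
    by (rule diff_squares_split_even[OF e h(1,2) \<open>odd y\<close> h(3) \<open>w > 0\<close>], rule that)
qed

text \<open>Second splitting: half the sum and half the difference of \<open>a^2\<close> and
  \<open>x\<close> are coprime with product \<open>c * b ^ 4\<close> and sum \<open>a^2\<close>. If
  \<open>c\<close> goes entirely to one of them, the original equation returns in \<open>d\<close>
  and \<open>e\<close>.\<close>

lemma square_eq_quartic_split:
  fixes x a b c :: nat
  assumes eq: "x\<^sup>2 + 4 * c * b ^ 4 = a ^ 4" and cop: "coprime x a" and "odd a" "c > 0" "b > 0"
  obtains l1 l2 d e where "c = l1 * l2" "b = d * e" "coprime (l1 * d ^ 4) (l2 * e ^ 4)"
    "a\<^sup>2 = l1 * d ^ 4 + l2 * e ^ 4"
proof -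
  have "even (4 * c * b ^ 4)" by simp
  moreover have "odd (a ^ 4)" using \<open>odd a\<close> by simp
  ultimately have "odd (x\<^sup>2)" by (metis eq even_add)
  then have "odd x" by simp
  have e: "(a\<^sup>2)\<^sup>2 = x\<^sup>2 + 4 * c * b ^ 4"
    using eq by simp
  have h: "coprime x (a\<^sup>2)" "odd (a\<^sup>2)" using cop \<open>odd a\<close> by simp_all
  show thesis
    by (rule diff_squares_split_even[OF e h(1) \<open>odd x\<close> h(2) \<open>c > 0\<close> \<open>b > 0\<close>], rule that)
qed

text \<open>Both \<open>d\<close> and \<open>e\<close> lie below \<open>z = 2 * w\<close>, so the
  induction applies whichever of them takes the role of \<open>z\<close>.\<close>

lemma less_double_product:
  fixes w a b d e :: nat
  assumes "w > 0" "w = a * b" "b = d * e"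
  shows "0 < d" "0 < e" "d < 2 * w" "e < 2 * w"
proof -
  have pos: "a > 0" "d > 0" "e > 0" using assms by auto
  then show "0 < d" "0 < e" by simp_all
  have "d \<le> d * e" "e \<le> d * e" "d * e \<le> a * (d * e)" using pos by auto
  moreover have "w = a * (d * e)" using assms by simp
  ultimately have "d \<le> w" "e \<le> w" using pos by simp_all
  then show "d < 2 * w" "e < 2 * w" using assms(1) by simp_all
qed

section \<open>The descents\<close>

text \<open>For odd \<open>z\<close> one splitting already contradicts the residues. For even
  \<open>z\<close> only \<open>k1 = 1\<close>, \<open>k2 = 4 * p\<close> survives, and the second
  splitting gives a smaller solution.\<close>

lemma no_square_prime:
  fixes p x y z :: nat
  assumes p: "prime p" "p mod 16 = 7 \<or> p mod 16 = 11"
    and "coprime x z" "z > 0"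
  shows "x ^ 4 + p * z ^ 4 \<noteq> y\<^sup>2"
  using assms(3,4)
proof (induction z arbitrary: x y rule: less_induct)
  case (less z)
  have p4: "4 * p mod 16 = 12"
    unfolding mod_mult_right_eq[of 4 p 16, symmetric] using p(2) by (elim disjE) simp_all
  have "odd p" using p(2) by presburger
  have "p > 0" using p(1) by (simp add: prime_gt_0_nat)
  show ?case
  proof
    assume eq: "x ^ 4 + p * z ^ 4 = y\<^sup>2"
    have cop: "coprime x y"
      by (rule coprime_if_no_common_square[of x z y p])
         (use less.prems eq prime_not_square_dvd[OF p(1)] in auto)
    show False
    proof (cases "even z")
      case False
      have e: "y\<^sup>2 = (x\<^sup>2)\<^sup>2 + p * z ^ 4" using eq by simp
      have h: "coprime (x\<^sup>2) y" "odd (p * z ^ 4)" using cop False \<open>odd p\<close> by simp_all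
      obtain k1 k2 a b where k: "p = k1 * k2" "z = a * b" "coprime (k1 * a ^ 4) (k2 * b ^ 4)"
        "2 * y = k1 * a ^ 4 + k2 * b ^ 4" "2 * x\<^sup>2 + k2 * b ^ 4 = k1 * a ^ 4"
        by (rule diff_squares_split_odd[OF e h])
      have "coprime k1 k2" using k(3) by simp
      then have "(k1, k2) = (1, p) \<or> (k1, k2) = (p, 1)"
        using coprime_mult_eq_two_power_mult_prime[OF p(1), of k1 k2 0] k(1) by auto
      moreover have "odd a" "odd b" using False k(2) by auto
      \<comment> \<open>Modulo 16, \<open>2 * x^2\<close> is 0, 2 or 8, whereas
        \<open>k1 - k2\<close> is 6 or 10.\<close>
      ultimately have "2 * x\<^sup>2 + k2 * b ^ 4 \<noteq> k1 * a ^ 4"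
        using square_plus_quartic_neq[of k2 "{1}" b k1 "{7, 11}" a 2 x]
          square_plus_quartic_neq[of k2 "{7, 11}" b k1 "{1}" a 2 x] p(2) by auto
      with k(5) show False by blast
    next
      case True
      then obtain w where w: "z = 2 * w" by blast
      have "w > 0" using less.prems w by simp
      have "odd x" using True less.prems(1) by (meson coprime_common_divisor odd_one)
      obtain k1 k2 a b where k: "4 * p = k1 * k2" "w = a * b" "coprime (k1 * a ^ 4) (k2 * b ^ 4)"
        and ab: "x\<^sup>2 + k2 * b ^ 4 = k1 * a ^ 4"
        by (rule quartic_eq_square_split[OF eq[unfolded w] cop \<open>odd x\<close> \<open>p > 0\<close> \<open>w > 0\<close>])
      have "coprime k1 k2" using k(3) by simp
      then consider "k1 = 1" "k2 = 4 * p" | "k1 = 4 * p" "k2 = 1" | "k1 = 4" "k2 = p" | "k1 = p" "k2 = 4"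
        using coprime_mult_eq_two_power_mult_prime[OF p(1), of k1 k2 2] k(1) by auto
      then show False
      proof cases
        case 1
        have "odd a" using k(3) 1 by auto
        have "b > 0" using \<open>w > 0\<close> k(2) by simp
        have ea: "x\<^sup>2 + 4 * p * b ^ 4 = a ^ 4" using ab 1 by simp
        have cxa: "coprime x a" using coprime_of_sum[OF ab k(3)] 1 by simp
        obtain l1 l2 d e where l: "p = l1 * l2" "b = d * e" "coprime (l1 * d ^ 4) (l2 * e ^ 4)"
          "a\<^sup>2 = l1 * d ^ 4 + l2 * e ^ 4"
          by (rule square_eq_quartic_split[OF ea cxa \<open>odd a\<close> \<open>p > 0\<close> \<open>b > 0\<close>])
        note lt = less_double_product[OF \<open>w > 0\<close> k(2) l(2), folded w]
        have "coprime l1 l2" "coprime d e" using l(3) by auto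
        then have "(l1, l2) = (1, p) \<or> (l1, l2) = (p, 1)"
          using coprime_mult_eq_two_power_mult_prime[OF p(1), of l1 l2 0] l(1) by auto
        then have "a\<^sup>2 = d ^ 4 + p * e ^ 4 \<or> a\<^sup>2 = e ^ 4 + p * d ^ 4" using l(4) by auto
        then show False
          using less.IH[OF lt(3)] less.IH[OF lt(4)] \<open>coprime d e\<close> lt(1,2) by (metis coprime_commute)
      next
        case 2
        then have "odd b" using k(3) by auto
        with 2 ab show False
          using square_plus_quartic_neq[of k2 "{1}" b k1 "{0, 12}" a 1 x] p4 by simp
      next
        case 3
        then have "odd b" using k(3) \<open>odd p\<close> by auto
        \<comment> \<open>Residues alone do not exclude \<open>x^2 + p * b ^ 4 = 4 * a ^ 4\<close>,
          so it is split once more as a difference of squares: modulo 16, \<open>4 * a^2\<close> is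
          0 or 4, but the sum of the two new factors is \<open>1 + p\<close>, that is 8 or
          12.\<close>
        have e: "(2 * a\<^sup>2)\<^sup>2 = x\<^sup>2 + p * b ^ 4" using ab 3 by (simp add: power_mult_distrib)
        have "coprime (x\<^sup>2) (4 * a ^ 4)" using coprime_of_sum[OF ab k(3)] 3 by simp
        then have cx: "coprime x (2 * a\<^sup>2)" using \<open>odd x\<close> by simp
        have h: "odd (p * b ^ 4)" using \<open>odd b\<close> \<open>odd p\<close> by simp
        obtain l1 l2 d f where l: "p = l1 * l2" "b = d * f" "coprime (l1 * d ^ 4) (l2 * f ^ 4)"
          "2 * (2 * a\<^sup>2) = l1 * d ^ 4 + l2 * f ^ 4" "2 * x + l2 * f ^ 4 = l1 * d ^ 4"
          by (rule diff_squares_split_odd[OF e cx h])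
        have "coprime l1 l2" using l(3) by simp
        then have "(l1, l2) = (1, p) \<or> (l1, l2) = (p, 1)"
          using coprime_mult_eq_two_power_mult_prime[OF p(1), of l1 l2 0] l(1) by auto
        moreover have "odd d" "odd f" using \<open>odd b\<close> l(2) by auto
        ultimately have "4 * a\<^sup>2 \<noteq> l1 * d ^ 4 + l2 * f ^ 4"
          using square_neq_quartic[of l1 "{1}" d l2 "{7, 11}" f 4 a]
            square_neq_quartic[of l1 "{7, 11}" d l2 "{1}" f 4 a] p(2) by auto
        with l(4) show False by simp
      next
        case 4
        then have "odd a" using k(3) \<open>odd p\<close> by auto
        with 4 ab show False
          using square_plus_quartic_neq[of k2 "{0, 4}" b k1 "{7, 11}" a 1 x] p(2) by simp
      qed
    qed
  qed
qed

text \<open>The equation is symmetric in \<open>x\<close> and \<open>z\<close>, so the descent can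
  keep an even number in the place of \<open>z\<close>.\<close>

lemma no_square_one_even:
  fixes x y z :: nat
  assumes "coprime x z" "even z" "z > 0"
  shows "x ^ 4 + z ^ 4 \<noteq> y\<^sup>2"
  using assms
proof (induction z arbitrary: x y rule: less_induct)
  case (less z)
  show ?case
  proof
    assume eq: "x ^ 4 + z ^ 4 = y\<^sup>2"
    have cop: "coprime x y"
      by (rule coprime_if_no_common_square[of x z y 1]) (use less.prems eq in auto)
    obtain w where w: "z = 2 * w" using less.prems by blast
    have "w > 0" using less.prems w by simp
    have "odd x" using less.prems by (meson coprime_common_divisor odd_one)
    have eq': "x ^ 4 + 1 * (2 * w) ^ 4 = y\<^sup>2" using eq w by simp
    obtain k1 k2 a b where k: "4 * 1 = k1 * k2" "w = a * b" "coprime (k1 * a ^ 4) (k2 * b ^ 4)"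
      and ab: "x\<^sup>2 + k2 * b ^ 4 = k1 * a ^ 4"
      by (rule quartic_eq_square_split[OF eq' cop \<open>odd x\<close> zero_less_one \<open>w > 0\<close>])
    have "coprime k1 k2" using k(3) by simp
    then consider "k1 = 1" "k2 = 4" | "k1 = 4" "k2 = 1"
      using coprime_mult_eq_two_power[of k1 k2 2] k(1) by auto
    then show False
    proof cases
      case 1
      have "odd a" using k(3) 1 by auto
      have "b > 0" using \<open>w > 0\<close> k(2) by simp
      have ea: "x\<^sup>2 + 4 * 1 * b ^ 4 = a ^ 4" using ab 1 by simp
      have cxa: "coprime x a" using coprime_of_sum[OF ab k(3)] 1 by simp
      obtain l1 l2 d e where l: "1 = l1 * l2" "b = d * e" "coprime (l1 * d ^ 4) (l2 * e ^ 4)"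
        "a\<^sup>2 = l1 * d ^ 4 + l2 * e ^ 4"
        by (rule square_eq_quartic_split[OF ea cxa \<open>odd a\<close> zero_less_one \<open>b > 0\<close>])
      note lt = less_double_product[OF \<open>w > 0\<close> k(2) l(2), folded w]
      have l1: "l1 = 1" "l2 = 1" using l(1) by auto
      have "coprime d e" using l(3) by auto
      have a2: "a\<^sup>2 = d ^ 4 + e ^ 4" using l(4) l1 by simp
      \<comment> \<open>Restores the parity hypothesis for the smaller solution, whose last variable
        is the even one of \<open>d\<close> and \<open>e\<close>.\<close>
      have "even d \<or> even e"
      proof (rule ccontr)
        assume "\<not> (even d \<or> even e)"
        then have "even (d ^ 4 + e ^ 4)" by simp
        with \<open>odd a\<close> show False by (simp flip: a2)
      qed
      then show False
        using less.IH[OF lt(3)] less.IH[OF lt(4)] a2 \<open>coprime d e\<close> lt(1,2)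
        by (metis coprime_commute add.commute)
    next
      case 2
      then have "odd b" using k(3) by auto
      with 2 ab show False
        using square_plus_quartic_neq[of k2 "{1}" b k1 "{0, 4}" a 1 x]  by simp
    qed
  qed
qed

text \<open>An odd \<open>z\<close> would make \<open>y^2\<close> equal to 2 or 3 modulo 16. For
  even \<open>z\<close> the factor 8 stays undivided; \<open>k1 = 8\<close> fails modulo 16 and
  \<open>k1 = 1\<close> descends.\<close>

lemma no_square_two:
  fixes x y z :: nat
  assumes "coprime x z" "z > 0"
  shows "x ^ 4 + 2 * z ^ 4 \<noteq> y\<^sup>2"
  using assms
proof (induction z arbitrary: x y rule: less_induct)
  case (less z)
  show ?case
  proof
    assume eq: "x ^ 4 + 2 * z ^ 4 = y\<^sup>2"
    have cop: "coprime x y"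
      by (rule coprime_if_no_common_square[of x z y 2])
         (use less.prems eq prime_not_square_dvd[OF two_is_prime_nat] in auto)
    have "even z"
    proof (rule ccontr)
      assume "odd z"
      then show False
        using square_neq_quartic[of 1 "{0, 1}" x 2 "{2}" z 1 y] eq by simp
    qed
    then obtain w where w: "z = 2 * w" by blast
    have "w > 0" using less.prems w by simp
    have "odd x" using \<open>even z\<close> less.prems(1) by (meson coprime_common_divisor odd_one)
    obtain k1 k2 a b where k: "4 * 2 = k1 * k2" "w = a * b" "coprime (k1 * a ^ 4) (k2 * b ^ 4)"
      and ab: "x\<^sup>2 + k2 * b ^ 4 = k1 * a ^ 4"
      by (rule quartic_eq_square_split[OF eq[unfolded w] cop \<open>odd x\<close> zero_less_numeral \<open>w > 0\<close>])
    have "coprime k1 k2" using k(3) by simp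
    then consider "k1 = 1" "k2 = 8" | "k1 = 8" "k2 = 1"
      using coprime_mult_eq_two_power[of k1 k2 3] k(1) by auto
    then show False
    proof cases
      case 1
      have "odd a" using k(3) 1 by auto
      have "b > 0" using \<open>w > 0\<close> k(2) by simp
      have ea: "x\<^sup>2 + 4 * 2 * b ^ 4 = a ^ 4" using ab 1 by simp
      have cxa: "coprime x a" using coprime_of_sum[OF ab k(3)] 1 by simp
      obtain l1 l2 d e where l: "2 = l1 * l2" "b = d * e" "coprime (l1 * d ^ 4) (l2 * e ^ 4)"
        "a\<^sup>2 = l1 * d ^ 4 + l2 * e ^ 4"
        by (rule square_eq_quartic_split[OF ea cxa \<open>odd a\<close> zero_less_numeral \<open>b > 0\<close>])
      note lt = less_double_product[OF \<open>w > 0\<close> k(2) l(2), folded w]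
      have "coprime l1 l2" "coprime d e" using l(3) by auto
      then have "(l1, l2) = (1, 2) \<or> (l1, l2) = (2, 1)"
        using coprime_mult_eq_two_power[of l1 l2 1] l(1) by auto
      then have "a\<^sup>2 = d ^ 4 + 2 * e ^ 4 \<or> a\<^sup>2 = e ^ 4 + 2 * d ^ 4" using l(4) by auto
      then show False
        using less.IH[OF lt(3)] less.IH[OF lt(4)] \<open>coprime d e\<close> lt(1,2) by (metis coprime_commute)
    next
      case 2
      then have "odd b" using k(3) by auto
      with 2 ab show False
        using square_plus_quartic_neq[of k2 "{1}" b k1 "{0, 8}" a 1 x]  by simp
    qed
  qed
qed

text \<open>Odd \<open>z\<close> fails because \<open>2 * p\<close> is 6 or 10 modulo 16. Residues
  leave only \<open>k1 = 1\<close> among the distributions of \<open>8 * p\<close>, and only those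
  keeping 2 and \<open>p\<close> together among the distributions of \<open>2 * p\<close>.\<close>

lemma no_square_two_prime:
  fixes p x y z :: nat
  assumes p: "prime p" "p mod 8 = 3 \<or> p mod 8 = 5"
    and "coprime x z" "z > 0"
  shows "x ^ 4 + 2 * p * z ^ 4 \<noteq> y\<^sup>2"
  using assms(3,4)
proof (induction z arbitrary: x y rule: less_induct)
  case (less z)
  have p16: "p mod 16 \<in> {3, 5, 11, 13}" using p(2) by simp presburger
  have p2: "2 * p mod 16 \<in> {6, 10}"
    unfolding mod_mult_right_eq[of 2 p 16, symmetric] using p16 by auto
  have p8: "8 * p mod 16 = 8"
    unfolding mod_mult_right_eq[of 8 p 16, symmetric] using p16 by auto
  have "odd p" using p(2) by presburger
  have "p > 0" using p(1) by (simp add: prime_gt_0_nat)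
  show ?case
  proof
    assume eq: "x ^ 4 + 2 * p * z ^ 4 = y\<^sup>2"
    have "even z"
    proof (rule ccontr)
      assume "odd z"
      then show False
        using square_neq_quartic[of 1 "{0, 1}" x "2 * p" "{6, 10}" z 1 y] eq p2 by simp
    qed
    then obtain w where w: "z = 2 * w" by blast
    have "w > 0" using less.prems w by simp
    have "odd x" using \<open>even z\<close> less.prems(1) by (meson coprime_common_divisor odd_one)
    have cop: "coprime x y"
    proof (rule coprime_if_no_common_square[of x z y "2 * p"])
      fix q :: nat assume q: "prime q" "q dvd x"
      then have "odd q" using \<open>odd x\<close> by (meson dvd_trans)
      then have "coprime (q\<^sup>2) 2" by simp
      then show "\<not> q\<^sup>2 dvd 2 * p"
        using prime_not_square_dvd[OF p(1) q(1)] by (simp add: coprime_dvd_mult_right_iff)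
    qed (use less.prems eq in auto)
    have "2 * p > 0" using \<open>p > 0\<close> by simp
    obtain k1 k2 a b where k: "4 * (2 * p) = k1 * k2" "w = a * b" "coprime (k1 * a ^ 4) (k2 * b ^ 4)"
      and ab: "x\<^sup>2 + k2 * b ^ 4 = k1 * a ^ 4"
      by (rule quartic_eq_square_split[OF eq[unfolded w] cop \<open>odd x\<close> \<open>2 * p > 0\<close> \<open>w > 0\<close>])
    have "coprime k1 k2" using k(3) by simp
    then consider "k1 = 1" "k2 = 8 * p" | "k1 = 8 * p" "k2 = 1" | "k1 = 8" "k2 = p" | "k1 = p" "k2 = 8"
      using coprime_mult_eq_two_power_mult_prime[OF p(1), of k1 k2 3] k(1) by auto
    then show False
    proof cases
      case 1
      have "odd a" using k(3) 1 by auto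
      have "b > 0" using \<open>w > 0\<close> k(2) by simp
      have ea: "x\<^sup>2 + 4 * (2 * p) * b ^ 4 = a ^ 4" using ab 1 by simp
      have cxa: "coprime x a" using coprime_of_sum[OF ab k(3)] 1 by simp
      obtain l1 l2 d e where l: "2 * p = l1 * l2" "b = d * e" "coprime (l1 * d ^ 4) (l2 * e ^ 4)"
        "a\<^sup>2 = l1 * d ^ 4 + l2 * e ^ 4"
        by (rule square_eq_quartic_split[OF ea cxa \<open>odd a\<close> \<open>2 * p > 0\<close> \<open>b > 0\<close>])
      note lt = less_double_product[OF \<open>w > 0\<close> k(2) l(2), folded w]
      have "coprime l1 l2" "coprime d e" using l(3) by auto
      \<comment> \<open>The right side is \<open>p\<close> or \<open>p + 2\<close> modulo 16, hence
        3, 5, 7, 11, 13 or 15, none of them a square.\<close>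
      have no: False if "a\<^sup>2 = 2 * f ^ 4 + p * g ^ 4" "odd g" for f g
        using square_neq_quartic[of 2 "{0, 2}" f p "{3, 5, 11, 13}" g 1 a] p16 that by simp
      consider "l1 = 1" "l2 = 2 * p" | "l1 = 2 * p" "l2 = 1" | "l1 = 2" "l2 = p" | "l1 = p" "l2 = 2"
        using coprime_mult_eq_two_power_mult_prime[OF p(1), of l1 l2 1] l(1) \<open>coprime l1 l2\<close> by auto
      then show False
      proof cases
        case 1
        then have "d ^ 4 + 2 * p * e ^ 4 = a\<^sup>2" using l(4) by simp
        with less.IH[OF lt(4) \<open>coprime d e\<close> lt(2)] show False by blast
      next
        case 2
        then have "e ^ 4 + 2 * p * d ^ 4 = a\<^sup>2" using l(4) by simp
        moreover have "coprime e d" using \<open>coprime d e\<close> by (simp add: coprime_commute)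
        ultimately show False using less.IH[OF lt(3) _ lt(1)] by blast
      next
        case 3
        then have "odd e" using l(3) by auto
        with no[of d e] l(4) 3 show False by simp
      next
        case 4
        then have "odd d" using l(3) by auto
        with no[of e d] l(4) 4 show False by (simp add: add.commute)
      qed
    next
      case 2
      then have "odd b" using k(3) by auto
      with 2 ab show False
        using square_plus_quartic_neq[of k2 "{1}" b k1 "{0, 8}" a 1 x] p8 by simp
    next
      case 3
      then have "odd b" using k(3) \<open>odd p\<close> by auto
      with 3 ab show False
        using square_plus_quartic_neq[of k2 "{3, 5, 11, 13}" b k1 "{0, 8}" a 1 x] p16 by simp
    next
      case 4
      then have "odd a" using k(3) \<open>odd p\<close> by auto
      with 4 ab show False
        using square_plus_quartic_neq[of k2 "{0, 8}" b k1 "{3, 5, 11, 13}" a 1 x] p16 by simp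
    qed
  qed
qed

section \<open>The cases \<open>c = 4 p\<close> and \<open>c = - p\<close>\<close>

text \<open>The two factors of \<open>(a^2)^2 - (2 * t)^2\<close> sum to \<open>2 * a^2\<close>,
  which is 2 modulo 16, but also to \<open>1 + p\<close>, which is 4, 12 or 14.\<close>

lemma no_square_plus_prime_eq_quartic_odd:
  fixes p t a b :: nat
  assumes p: "prime p" "p mod 16 \<in> {3, 11, 13}" and "odd a" "odd b" and cop: "coprime t a"
  shows "4 * t\<^sup>2 + p * b ^ 4 \<noteq> a ^ 4"
proof
  assume eq: "4 * t\<^sup>2 + p * b ^ 4 = a ^ 4"
  have "odd p" using p(2) by simp presburger
  have e: "(a\<^sup>2)\<^sup>2 = (2 * t)\<^sup>2 + p * b ^ 4" using eq by (simp add: power_mult_distrib)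
  have h: "coprime (2 * t) (a\<^sup>2)" "odd (p * b ^ 4)" using assms \<open>odd p\<close> by simp_all
  obtain k1 k2 d f where k: "p = k1 * k2" "b = d * f" "coprime (k1 * d ^ 4) (k2 * f ^ 4)"
    "2 * a\<^sup>2 = k1 * d ^ 4 + k2 * f ^ 4" "2 * (2 * t) + k2 * f ^ 4 = k1 * d ^ 4"
    by (rule diff_squares_split_odd[OF e h])
  have "coprime k1 k2" using k(3) by simp
  then have "(k1, k2) = (1, p) \<or> (k1, k2) = (p, 1)"
    using coprime_mult_eq_two_power_mult_prime[OF p(1), of k1 k2 0] k(1) by auto
  moreover have "odd d" "odd f" using \<open>odd b\<close> k(2) by auto
  ultimately have "2 * a\<^sup>2 \<noteq> k1 * d ^ 4 + k2 * f ^ 4"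
    using square_neq_quartic[of k1 "{1}" d k2 "{3, 11, 13}" f 2 a]
      square_neq_quartic[of k1 "{3, 11, 13}" d k2 "{1}" f 2 a] p(2) by auto
  with k(4) show False by blast
qed

text \<open>Excludes the distributions of \<open>4 * p\<close> that separate 4 from
  \<open>p\<close>. Splitting \<open>s^2 - (2 * t^2)^2\<close> leaves \<open>k1 = 1\<close>, which
  is the preceding lemma, and \<open>k1 = p\<close>, which fails modulo 16.\<close>

lemma no_square_four_quartic_plus_prime:
  fixes p s t z :: nat
  assumes p: "prime p" "p mod 16 \<in> {3, 11, 13}" and cop: "coprime t z" and "odd z"
  shows "s\<^sup>2 \<noteq> 4 * t ^ 4 + p * z ^ 4"
proof
  assume eq: "s\<^sup>2 = 4 * t ^ 4 + p * z ^ 4"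
  have "odd p" using p(2) by simp presburger
  have "odd (4 * t ^ 4 + p * z ^ 4)" using \<open>odd p\<close> \<open>odd z\<close> by simp
  then have "odd (s\<^sup>2)" by (simp only: eq not_False_eq_True)
  then have "odd s" by simp
  have e: "s\<^sup>2 = (2 * t\<^sup>2)\<^sup>2 + p * z ^ 4" using eq by (simp add: power_mult_distrib)
  have "coprime t s"
  proof (rule ccontr)
    assume "\<not> coprime t s"
    then obtain q where q: "prime q" "q dvd t" "q dvd s"
      by (metis coprime_iff_gcd_eq_1 gcd_dvd1 gcd_dvd2 prime_factor_nat dvd_trans)
    have "4 * t ^ 4 = (4 * t\<^sup>2) * t\<^sup>2" by (simp add: power2_eq_square power4_eq_xxxx)
    moreover have "q\<^sup>2 dvd t\<^sup>2" "q\<^sup>2 dvd s\<^sup>2" using q by simp_all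
    ultimately have "q\<^sup>2 dvd 4 * t ^ 4" "q\<^sup>2 dvd 4 * t ^ 4 + p * z ^ 4" by (metis dvd_mult, metis eq)
    then have "q\<^sup>2 dvd p * z ^ 4" by (metis dvd_add_right_iff)
    moreover have "coprime (q\<^sup>2) (z ^ 4)"
      using q(2) cop by (metis coprime_divisors coprime_power_left_iff coprime_power_right_iff dvd_refl)
    ultimately have "q\<^sup>2 dvd p" by (simp add: coprime_dvd_mult_left_iff)
    with prime_not_square_dvd[OF p(1) q(1)] show False by blast
  qed
  then have h: "coprime (2 * t\<^sup>2) s" "odd (p * z ^ 4)"
    using \<open>odd p\<close> \<open>odd z\<close> \<open>odd s\<close> by simp_all
  obtain k1 k2 a b where k: "p = k1 * k2" "z = a * b" "coprime (k1 * a ^ 4) (k2 * b ^ 4)"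
    "2 * s = k1 * a ^ 4 + k2 * b ^ 4" "2 * (2 * t\<^sup>2) + k2 * b ^ 4 = k1 * a ^ 4"
    by (rule diff_squares_split_odd[OF e h])
  have eq4: "4 * t\<^sup>2 + k2 * b ^ 4 = k1 * a ^ 4" using k(5) by simp
  have odd: "odd a" "odd b" using \<open>odd z\<close> k(2) by auto
  have "coprime k1 k2" using k(3) by simp
  then have "(k1, k2) = (1, p) \<or> (k1, k2) = (p, 1)"
    using coprime_mult_eq_two_power_mult_prime[OF p(1), of k1 k2 0] k(1) by auto
  then consider "k1 = 1" "k2 = p" | "k1 = p" "k2 = 1" by auto
  then show False
  proof cases
    case 1
    have "coprime (4 * t\<^sup>2) (k1 * a ^ 4)" by (rule coprime_of_sum[OF eq4 k(3)])
    then have "coprime t a" using 1 by simp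
    from no_square_plus_prime_eq_quartic_odd[OF p odd this] eq4 1 show False by simp
  next
    case 2
    then show False
      using square_plus_quartic_neq[of k2 "{1}" b k1 "{3, 11, 13}" a 4 t] p(2) odd eq4 by simp
  qed
qed

text \<open>An even \<open>a\<close> makes the right side 0 modulo 16, but \<open>- p\<close> is
  then 13, 5 or 3, not a square.\<close>

lemma square_plus_prime_eq_quartic_imp_odd:
  fixes p x a b :: nat
  assumes p: "p mod 16 \<in> {3, 11, 13}" and eq: "x\<^sup>2 + p * b ^ 4 = a ^ 4" and "odd b"
  shows "odd a"
proof
  assume "even a"
  then obtain c where c: "a = 2 * c" by blast
  have "1 * x\<^sup>2 + p * b ^ 4 = 16 * c ^ 4" using eq by (simp add: c power_mult_distrib)
  moreover have "1 * x\<^sup>2 + p * b ^ 4 \<noteq> 16 * c ^ 4"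
    by (rule square_plus_quartic_neq[of _ "{3, 11, 13}" _ _ "{0}"]) (use p \<open>odd b\<close> in auto)
  ultimately show False by blast
qed

text \<open>Shared by the descent for \<open>4 * p\<close> and the reduction of \<open>- p\<close>
  to it: the second splitting distributes \<open>4 * p\<close>, and the only admissible
  distributions reproduce the equation for \<open>4 * p\<close>.\<close>

lemma square_plus_sixteen_prime_split:
  fixes p x a w :: nat
  assumes p: "prime p" "p mod 16 \<in> {3, 11, 13}"
    and eq: "x\<^sup>2 + 4 * (4 * p) * w ^ 4 = a ^ 4" and cop: "coprime x a" and "odd a" "w > 0"
  obtains d e where "coprime d e" "0 < e" "e \<le> w" "d ^ 4 + 4 * p * e ^ 4 = a\<^sup>2"
proof -
  have "4 * p > 0" using p(1) by (simp add: prime_gt_0_nat)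
  obtain l1 l2 d e where l: "4 * p = l1 * l2" "w = d * e" "coprime (l1 * d ^ 4) (l2 * e ^ 4)"
    "a\<^sup>2 = l1 * d ^ 4 + l2 * e ^ 4"
    by (rule square_eq_quartic_split[OF eq cop \<open>odd a\<close> \<open>4 * p > 0\<close> \<open>w > 0\<close>])
  have "coprime l1 l2" "coprime d e" "coprime e d" using l(3) by (auto simp: coprime_commute)
  have de: "0 < d" "0 < e" "d \<le> w" "e \<le> w" using \<open>w > 0\<close> l(2) by auto
  consider "l1 = 1" "l2 = 4 * p" | "l1 = 4 * p" "l2 = 1" | "l1 = 4" "l2 = p" | "l1 = p" "l2 = 4"
    using coprime_mult_eq_two_power_mult_prime[OF p(1), of l1 l2 2] l(1) \<open>coprime l1 l2\<close> by auto
  then show thesis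
  proof cases
    case 1
    then show thesis using that[of d e] l(4) \<open>coprime d e\<close> de by simp
  next
    case 2
    then show thesis using that[of e d] l(4) \<open>coprime e d\<close> de by simp
  next
    case 3
    then have "odd e" using l(3) p(2) by auto
    with no_square_four_quartic_plus_prime[OF p \<open>coprime d e\<close>] l(4) 3 show thesis by simp
  next
    case 4
    then have "odd d" using l(3) by auto
    with no_square_four_quartic_plus_prime[OF p \<open>coprime e d\<close>] l(4) 4 show thesis
      by (simp add: add.commute)
  qed
qed

text \<open>Even \<open>x\<close> leads, after division by 4, to an equation already excluded. For
  odd \<open>x\<close> the coefficient 4 permits the first splitting whatever the parity of
  \<open>z\<close>, and only \<open>p\<close> is left to distribute.\<close>

lemma no_square_four_prime:
  fixes p x y z :: nat
  assumes p: "prime p" "p mod 16 \<in> {3, 11, 13}"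
    and "coprime x z" "z > 0"
  shows "x ^ 4 + 4 * p * z ^ 4 \<noteq> y\<^sup>2"
  using assms(3,4)
proof (induction z arbitrary: x y rule: less_induct)
  case (less z)
  have "odd p" using p(2) by simp presburger
  have "p > 0" using p(1) by (simp add: prime_gt_0_nat)
  show ?case
  proof
    assume eq: "x ^ 4 + 4 * p * z ^ 4 = y\<^sup>2"
    show False
    proof (cases "even x")
      case True
      then obtain t where t: "x = 2 * t" by blast
      have "even (x ^ 4 + 4 * p * z ^ 4)" using True by simp
      then have "even (y\<^sup>2)" by (simp only: eq not_False_eq_True)
      then have "even y" by simp
      then obtain s where s: "y = 2 * s" by blast
      have "odd z" using True less.prems(1) by (meson coprime_common_divisor odd_one)
      moreover have "coprime t z" using less.prems(1) t by simp
      moreover have "s\<^sup>2 = 4 * t ^ 4 + p * z ^ 4"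
        using eq by (simp add: s t power_mult_distrib)
      ultimately show False using no_square_four_quartic_plus_prime[OF p] by blast
    next
      case False
      have cop: "coprime x y"
      proof (rule coprime_if_no_common_square[of x z y "4 * p"])
        fix q :: nat assume q: "prime q" "q dvd x"
        then have "odd q" using False by (meson dvd_trans)
        then have "coprime (q\<^sup>2) (2\<^sup>2)" by (simp only: coprime_power_left_iff coprime_power_right_iff) simp
        then have "coprime (q\<^sup>2) 4" by simp
        then show "\<not> q\<^sup>2 dvd 4 * p"
          using prime_not_square_dvd[OF p(1) q(1)] by (simp only: coprime_dvd_mult_right_iff not_False_eq_True)
      qed (use less.prems eq in auto)
      have "odd (x ^ 4 + 4 * p * z ^ 4)" using False by simp
      then have "odd (y\<^sup>2)" by (simp only: eq not_False_eq_True)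
      then have "odd y" by simp
      have e: "y\<^sup>2 = (x\<^sup>2)\<^sup>2 + 4 * p * z ^ 4" using eq by simp
      have h: "coprime (x\<^sup>2) y" "odd (x\<^sup>2)" using cop False by simp_all
      obtain k1 k2 a b where k: "p = k1 * k2" "z = a * b" "coprime (k1 * a ^ 4) (k2 * b ^ 4)"
        "y = k1 * a ^ 4 + k2 * b ^ 4" and ab: "x\<^sup>2 + k2 * b ^ 4 = k1 * a ^ 4"
        by (rule diff_squares_split_even[OF e h \<open>odd y\<close> \<open>p > 0\<close> less.prems(2)])
      have "coprime k1 k2" "coprime a b" using k(3) by auto
      then have "odd a \<or> odd b" by (meson coprime_common_divisor odd_one)
      have "(k1, k2) = (1, p) \<or> (k1, k2) = (p, 1)"
        using coprime_mult_eq_two_power_mult_prime[OF p(1), of k1 k2 0] k(1) \<open>coprime k1 k2\<close> by auto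
      then consider "k1 = 1" "k2 = p" | "k1 = p" "k2 = 1" by auto
      then show False
      proof cases
        case 1
        have cxa: "coprime x a" using coprime_of_sum[OF ab k(3)] 1 by simp
        have "odd a"
        proof (cases "odd b")
          case True
          then show ?thesis using square_plus_prime_eq_quartic_imp_odd[OF p(2), of x b a] ab 1 by simp
        qed (use \<open>odd a \<or> odd b\<close> in blast)
        \<comment> \<open>With \<open>b = 2 * w\<close> the coefficient becomes
          \<open>16 * p\<close>, the form that the second splitting needs.\<close>
        have "even b"
        proof (rule ccontr)
          assume "odd b"
          have "even (k1 * a ^ 4)" 
            using ab h(2) \<open>odd b\<close> \<open>odd p\<close> 1 by (metis even_add even_mult_iff even_power)
          with \<open>odd a\<close> 1 show False by simp
        qed
        then obtain w where w: "b = 2 * w" by blast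
        have "w > 0" using less.prems k(2) w by auto
        have ea: "x\<^sup>2 + 4 * (4 * p) * w ^ 4 = a ^ 4"
          using ab 1 by (simp add: w power_mult_distrib)
        obtain d e where de: "coprime d e" "0 < e" "e \<le> w" "d ^ 4 + 4 * p * e ^ 4 = a\<^sup>2"
          by (rule square_plus_sixteen_prime_split[OF p ea cxa \<open>odd a\<close> \<open>w > 0\<close>])
        have "w < b" "a > 0" using w \<open>w > 0\<close> \<open>odd a\<close> by (auto intro!: gr0I)
        then have "e < z" using de(3) k(2) by (metis le_less_trans less_le_trans mult_le_mono1 mult_1 Suc_leI One_nat_def)
        with less.IH[OF _ de(1,2)] de(4) show False by blast
      next
        case 2
        \<comment> \<open>One of \<open>a\<close> and \<open>b\<close> is odd; the one that may be
          even contributes the extra residue 0.\<close>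
        have "1 * x\<^sup>2 + k2 * b ^ 4 \<noteq> k1 * a ^ 4"
        proof (cases "odd a")
          case True
          then show ?thesis
            by (intro square_plus_quartic_neq[of _ "{0, 1}" _ _ "{3, 11, 13}"]) (use p(2) 2 in auto)
        next
          case False
          then have "odd b" using \<open>odd a \<or> odd b\<close> by blast
          then show ?thesis
            by (intro square_plus_quartic_neq[of _ "{1}" _ _ "{0, 3, 11, 13}"]) (use p(2) 2 in auto)
        qed
        with ab show False by simp
      qed
    qed
  qed
qed

text \<open>No separate descent: even \<open>z\<close> produces a solution for \<open>4 * p\<close>,
  and odd \<open>z\<close> makes \<open>y\<close> even, which is excluded by one splitting.\<close>

lemma no_square_minus_prime:
  fixes p x y z :: nat
  assumes p: "prime p" "p mod 16 \<in> {3, 11, 13}"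
    and xz: "coprime x z" and "z > 0"
  shows "y\<^sup>2 + p * z ^ 4 \<noteq> x ^ 4"
proof
  assume eq: "y\<^sup>2 + p * z ^ 4 = x ^ 4"
  have "odd p" using p(2) by simp presburger
  have cop: "coprime y x"
    using coprime_if_no_common_square[of x z y p] xz eq prime_not_square_dvd[OF p(1)]
    by (simp add: coprime_commute)
  have "odd x"
  proof (cases "odd z")
    case True
    then show ?thesis using square_plus_prime_eq_quartic_imp_odd[OF p(2) eq] by blast
  next
    case False
    with xz show ?thesis by (meson coprime_common_divisor odd_one)
  qed
  show False
  proof (cases "even z")
    case True
    then obtain w where w: "z = 2 * w" by blast
    have "w > 0" using \<open>z > 0\<close> w by simp
    have e: "y\<^sup>2 + 4 * (4 * p) * w ^ 4 = x ^ 4" using eq by (simp add: w power_mult_distrib)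
    obtain d e where de: "coprime d e" "0 < e" "e \<le> w" "d ^ 4 + 4 * p * e ^ 4 = x\<^sup>2"
      by (rule square_plus_sixteen_prime_split[OF p e cop \<open>odd x\<close> \<open>w > 0\<close>])
    with no_square_four_prime[OF p de(1,2)] show False by blast
  next
    case False
    have "even (y\<^sup>2)"
    proof (rule ccontr)
      assume "odd (y\<^sup>2)"
      then have "even (y\<^sup>2 + p * z ^ 4)" using \<open>odd p\<close> False by simp
      with \<open>odd x\<close> show False unfolding eq by simp
    qed
    then have "even y" by simp
    then obtain t where t: "y = 2 * t" by blast
    have "coprime t x" using cop t by simp
    moreover have "4 * t\<^sup>2 + p * z ^ 4 = x ^ 4" using eq by (simp add: t power_mult_distrib)
    ultimately show False
      using no_square_plus_prime_eq_quartic_odd[OF p \<open>odd x\<close> False] by blast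
  qed
qed

section \<open>Compositions with a quadratic polynomial\<close>

text \<open>The substitution is inverted by \<open>L\<close>, so factorizations pull back to
  \<open>f\<close>; degrees, and with them units, are preserved.\<close>

lemma irreducible_pcompose_linear:
  fixes f :: "'a::field poly"
  assumes irr: "irreducible f" and "a \<noteq> 0"
  shows "irreducible (f \<circ>\<^sub>p [:b, a:])"
proof (rule irreducibleI)
  have deg: "degree (h \<circ>\<^sub>p [:b, a:]) = degree h" for h :: "'a poly"
    using \<open>a \<noteq> 0\<close> by (simp add: degree_pcompose)
  have z: "h \<circ>\<^sub>p [:b, a:] = 0 \<longleftrightarrow> h = 0" for h :: "'a poly"
    using \<open>a \<noteq> 0\<close> by (simp add: pcompose_eq_0_iff)
  show "f \<circ>\<^sub>p [:b, a:] \<noteq> 0" using irr z by auto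
  then show "\<not> is_unit (f \<circ>\<^sub>p [:b, a:])"
    using irr deg[of f] by (auto simp: is_unit_iff_degree irreducible_def)
  fix A B assume AB: "f \<circ>\<^sub>p [:b, a:] = A * B"
  define L where "L = [:- b / a, 1 / a:]"
  have L: "[:b, a:] \<circ>\<^sub>p L = [:0, 1:]" using \<open>a \<noteq> 0\<close> by (simp add: L_def pcompose_pCons)
  have "f = (A \<circ>\<^sub>p L) * (B \<circ>\<^sub>p L)"
    by (metis AB L pcompose_assoc pcompose_idR pcompose_mult)
  then have "is_unit (A \<circ>\<^sub>p L) \<or> is_unit (B \<circ>\<^sub>p L)" "A \<circ>\<^sub>p L \<noteq> 0" "B \<circ>\<^sub>p L \<noteq> 0"
    using irr by (auto simp: irreducible_def)
  then show "is_unit A \<or> is_unit B"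
    using \<open>a \<noteq> 0\<close> \<open>f \<circ>\<^sub>p [:b, a:] \<noteq> 0\<close> AB
    by (auto simp: is_unit_iff_degree L_def degree_pcompose)
qed

section \<open>Even and odd parts of a polynomial\<close>

lemma even_odd_decomposition:
  fixes A :: "'a::comm_ring_1 poly"
  obtains E H where "A = E \<circ>\<^sub>p [:0, 0, 1:] + [:0, 1:] * (H \<circ>\<^sub>p [:0, 0, 1:])"
proof -
  have "\<exists>E H. A = E \<circ>\<^sub>p [:0, 0, 1:] + [:0, 1:] * (H \<circ>\<^sub>p [:0, 0, 1:])"
  proof (induction A)
    case 0
    show ?case by (intro exI[of _ 0]) simp
  next
    case (pCons c A)
    then obtain E H where A: "A = E \<circ>\<^sub>p [:0, 0, 1:] + [:0, 1:] * (H \<circ>\<^sub>p [:0, 0, 1:])" by blast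
    \<comment> \<open>Multiplication by \<open>x\<close> exchanges the two parts, and the new
      constant \<open>c\<close> joins the even one.\<close>
    show ?case
      by (intro exI[of _ "pCons c H"] exI[of _ E], subst A)
         (simp add: pcompose_pCons algebra_simps)
  qed
  with that show thesis by blast
qed

text \<open>Substituting \<open>x^2\<close> doubles degrees, so a nonzero remainder modulo
  \<open>G\<close> still has too small a degree to be divisible after substitution.\<close>

lemma pcompose_square_dvd_iff:
  fixes F G :: "'a::field_gcd poly"
  shows "G \<circ>\<^sub>p [:0, 0, 1:] dvd F \<circ>\<^sub>p [:0, 0, 1:] \<longleftrightarrow> G dvd F"
proof
  assume "G dvd F"
  then show "G \<circ>\<^sub>p [:0, 0, 1:] dvd F \<circ>\<^sub>p [:0, 0, 1:]"
    by (auto simp: pcompose_mult elim!: dvdE)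
next
  assume d: "G \<circ>\<^sub>p [:0, 0, 1:] dvd F \<circ>\<^sub>p [:0, 0, 1:]"
  have z: "h \<circ>\<^sub>p [:0, 0, 1:] = 0 \<longleftrightarrow> h = 0" for h :: "'a poly"
    by (simp add: pcompose_eq_0_iff)
  have "F \<circ>\<^sub>p [:0, 0, 1:] = (G * (F div G) + F mod G) \<circ>\<^sub>p [:0, 0, 1:]" by simp
  also have "\<dots> = (G \<circ>\<^sub>p [:0, 0, 1:]) * ((F div G) \<circ>\<^sub>p [:0, 0, 1:]) + (F mod G) \<circ>\<^sub>p [:0, 0, 1:]"
    by (simp only: pcompose_add pcompose_mult)
  finally have d': "G \<circ>\<^sub>p [:0, 0, 1:] dvd (F mod G) \<circ>\<^sub>p [:0, 0, 1:]"
    using d by (metis dvd_add_right_iff dvd_triv_left)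
  have "F mod G = 0"
  proof (rule ccontr)
    assume n: "F mod G \<noteq> 0"
    then have "G \<noteq> 0 \<Longrightarrow> degree (F mod G) < degree G" by (simp add: degree_mod_less')
    moreover have "degree (G \<circ>\<^sub>p [:0, 0, 1:]) \<le> degree ((F mod G) \<circ>\<^sub>p [:0, 0, 1:])"
      using d' n z by (intro dvd_imp_degree_le) auto
    moreover have "G \<noteq> 0" using d' n by (metis dvd_0_left pcompose_0 z)
    ultimately show False by (simp add: degree_pcompose)
  qed
  then show "G dvd F" by presburger
qed

text \<open>If nonzero, the left side has even degree and the right side odd degree.\<close>

lemma even_eq_odd_imp_zero:
  fixes E H :: "'a::field poly"
  assumes "E \<circ>\<^sub>p [:0, 0, 1:] = [:0, 1:] * (H \<circ>\<^sub>p [:0, 0, 1:])"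
  shows "E = 0 \<and> H = 0"
proof -
  have z: "h \<circ>\<^sub>p [:0, 0, 1:] = 0 \<longleftrightarrow> h = 0" for h :: "'a poly"
    by (simp add: pcompose_eq_0_iff)
  have "H = 0"
  proof (rule ccontr)
    assume "H \<noteq> 0"
    then have "degree ([:0, 1:] * (H \<circ>\<^sub>p [:0, 0, 1:])) = 1 + degree (H \<circ>\<^sub>p [:0, 0, 1:])"
      using z by (subst degree_mult_eq) auto
    then have "degree (E \<circ>\<^sub>p [:0, 0, 1:]) = 1 + degree (H \<circ>\<^sub>p [:0, 0, 1:])"
      using assms by metis
    then have "2 * degree E = 1 + 2 * degree H" by (simp add: degree_pcompose)
    then show False by presburger
  qed
  with assms z show ?thesis by auto
qed

text \<open>A prime factor \<open>A\<close> of \<open>F(x^2)\<close> and its mirror image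
  \<open>A' = A(-x)\<close> both divide \<open>F(x^2)\<close>. If \<open>A\<close> divides
  \<open>A'\<close>, then \<open>A\<close> is even and associated to \<open>F(x^2)\<close>, which is
  then irreducible. Otherwise they are coprime, and their product, \<open>E^2 - t H^2\<close> at
  \<open>t = x^2\<close>, gives a non-unit divisor of \<open>F\<close>.\<close>

lemma reducible_pcompose_square:
  fixes F :: "'a::{field_char_0,field_gcd} poly"
  assumes irr: "irreducible F" and deg: "degree F > 1"
    and red: "\<not> irreducible (F \<circ>\<^sub>p [:0, 0, 1:])"
  obtains k E H where "k \<noteq> 0" "F = smult k (E\<^sup>2 - [:0, 1:] * H\<^sup>2)"
proof -
  let ?s = "[:0, 0, 1:] :: 'a poly"
  let ?m = "[:0, -1:] :: 'a poly"
  have z: "h \<circ>\<^sub>p ?s = 0 \<longleftrightarrow> h = 0" for h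
    by (simp add: pcompose_eq_0_iff)
  have sm: "?s \<circ>\<^sub>p ?m = ?s" by (simp add: pcompose_pCons)
  have "F \<noteq> 0" using irr by auto
  have nu: "\<not> is_unit (F \<circ>\<^sub>p ?s)"
    using deg \<open>F \<noteq> 0\<close> z[of F] by (simp add: is_unit_iff_degree degree_pcompose)
  obtain A where A: "prime_elem A" "A dvd F \<circ>\<^sub>p ?s"
    using prime_divisor_exists[of "F \<circ>\<^sub>p ?s"] nu z[of F] \<open>F \<noteq> 0\<close> by auto
  obtain E H where EH: "A = E \<circ>\<^sub>p ?s + [:0, 1:] * (H \<circ>\<^sub>p ?s)"
    by (rule even_odd_decomposition)
  define A' where "A' = A \<circ>\<^sub>p ?m"
  have A': "A' = E \<circ>\<^sub>p ?s - [:0, 1:] * (H \<circ>\<^sub>p ?s)"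
  proof -
    have "A' = E \<circ>\<^sub>p (?s \<circ>\<^sub>p ?m) + ([:0, 1:] \<circ>\<^sub>p ?m) * (H \<circ>\<^sub>p (?s \<circ>\<^sub>p ?m))"
      unfolding A'_def EH by (simp only: pcompose_add pcompose_mult pcompose_assoc)
    then show ?thesis unfolding sm by (simp add: pcompose_pCons)
  qed
  have F': "F \<circ>\<^sub>p ?s = (F \<circ>\<^sub>p ?s) \<circ>\<^sub>p ?m" by (metis pcompose_assoc sm)
  have A'd: "A' dvd F \<circ>\<^sub>p ?s"
    using A(2) by (subst F') (auto simp: A'_def pcompose_mult elim!: dvdE)
  \<comment> \<open>Prevents \<open>A\<close> from being odd: an irreducible \<open>F\<close> of
    degree above 1 has no root at 0.\<close>
  have x0: "\<not> [:0, 1:] dvd F \<circ>\<^sub>p ?s"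
  proof
    assume "[:0, 1:] dvd F \<circ>\<^sub>p ?s"
    then have "poly (F \<circ>\<^sub>p ?s) 0 = 0" by (metis poly_eq_0_iff_dvd minus_zero)
    then have "poly F 0 = 0" by (simp add: poly_pcompose)
    then have "[:0, 1:] dvd F" by (metis poly_eq_0_iff_dvd minus_zero)
    then have "is_unit [:0, 1 :: 'a:] \<or> F dvd [:0, 1:]" using irr irreducibleD' by blast
    then show False using deg dvd_imp_degree_le[of F "[:0, 1:]"] by (auto simp: is_unit_iff_degree)
  qed
  show thesis
  proof (cases "A dvd A'")
    case True
    have "A \<noteq> 0" using A(1) by auto
    then have "A' \<noteq> 0" "degree A' = degree A"
      by (auto simp: A'_def pcompose_eq_0_iff degree_pcompose)
    obtain q where q: "A' = A * q" using True by blast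
    with \<open>A' \<noteq> 0\<close> \<open>degree A' = degree A\<close> have "degree q = 0" by (auto simp: degree_mult_eq)
    then obtain u where u: "q = [:u:]" by (metis degree_eq_zeroE)
    define P Q U where "P = E \<circ>\<^sub>p ?s" "Q = [:0, 1:] * (H \<circ>\<^sub>p ?s)" "U = [:u:]"
    \<comment> \<open>Separating \<open>A' = u * A\<close> into even and odd parts gives
      \<open>(1 - u) * E = 0\<close> and \<open>(1 + u) * H = 0\<close>; as \<open>E\<close> is
      nonzero, \<open>u = 1\<close> and \<open>H = 0\<close>.\<close>
    have "P - Q = (P + Q) * U"
      using q u EH A' by (simp only: P_Q_U_def)
    then have "(1 - U) * P = (1 + U) * Q" by (simp add: algebra_simps)
    moreover have "1 - U = [:1 - u:]" "1 + U = [:1 + u:]"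
      by (simp_all add: P_Q_U_def one_pCons)
    ultimately have "[:1 - u:] * (E \<circ>\<^sub>p ?s) = [:0, 1:] * ([:1 + u:] * (H \<circ>\<^sub>p ?s))"
      by (simp only: P_Q_U_def mult.left_commute)
    then have "([:1 - u:] * E) \<circ>\<^sub>p ?s = [:0, 1:] * (([:1 + u:] * H) \<circ>\<^sub>p ?s)"
      by (simp only: pcompose_mult pcompose_const)
    from even_eq_odd_imp_zero[OF this] have h: "(1 - u = 0 \<or> E = 0) \<and> (1 + u = 0 \<or> H = 0)"
      by auto
    have "E \<noteq> 0"
    proof
      assume "E = 0"
      then have "[:0, 1:] dvd A" using EH by (metis add_0 dvd_triv_left pcompose_0)
      with A(2) x0 show False using dvd_trans by blast
    qed
    with h have "u = 1" by auto
    with h have "H = 0" by auto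
    with EH have AE: "A = E \<circ>\<^sub>p ?s" by simp
    with A(2) have "E dvd F" by (simp add: pcompose_square_dvd_iff)
    moreover have "\<not> is_unit E"
      using A(1) AE \<open>E \<noteq> 0\<close> z[of E]
      by (auto simp: prime_elem_def is_unit_iff_degree degree_pcompose)
    ultimately have "F dvd E" using irr irreducibleD' by blast
    then have "F \<circ>\<^sub>p ?s dvd A" by (simp add: AE pcompose_square_dvd_iff)
    then obtain q where q: "A = (F \<circ>\<^sub>p ?s) * q" by blast
    have iA: "irreducible A" using A(1) by (rule prime_elem_imp_irreducible)
    then have "is_unit q" using irreducibleD[OF iA q] nu by blast
    then have "irreducible (F \<circ>\<^sub>p ?s)"
      using iA irreducible_mult_unit_left[of q] by (simp add: q mult.commute)
    with red show thesis by blast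
  next
    case False
    then have "coprime A A'" using A(1) prime_elem_imp_coprime by blast
    then have "A * A' dvd F \<circ>\<^sub>p ?s" using A(2) A'd by (simp add: divides_mult)
    moreover have N: "A * A' = (E\<^sup>2 - [:0, 1:] * H\<^sup>2) \<circ>\<^sub>p ?s"
      by (simp add: EH A' pcompose_diff pcompose_mult power2_eq_square pcompose_pCons algebra_simps)
    ultimately have "E\<^sup>2 - [:0, 1:] * H\<^sup>2 dvd F" (is "?N dvd F")
      by (simp only: pcompose_square_dvd_iff)
    moreover have "\<not> is_unit ?N"
    proof
      assume "is_unit ?N"
      then have "is_unit (?N \<circ>\<^sub>p ?s)"
        by (metis (no_types, lifting) pcompose_1 pcompose_square_dvd_iff)
      then show False using A(1) N by (metis dvd_mult_left prime_elem_def)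
    qed
    ultimately obtain q where q: "F = ?N * q" "is_unit q"
      using irreducibleD[OF irr] by blast
    then obtain k where "q = [:k:]" "is_unit k" using is_unit_polyE by blast
    then have "k \<noteq> 0" by auto
    have "F = smult k ?N" using q \<open>q = [:k:]\<close> by simp
    with \<open>k \<noteq> 0\<close> that show thesis by blast
  qed
qed


text \<open>The quadratic is \<open>[:b, a:]\<close> after squaring after a shift, so the preceding
  lemma applies to \<open>F\<close>. Its inverse substitution \<open>M\<close> returns to
  \<open>f\<close> and turns the factor \<open>t\<close> into \<open>(x - b) / a\<close>.\<close>

lemma reducible_pcompose_quadratic:
  fixes f :: "'a::{field_char_0,field_gcd} poly"
  assumes irr: "irreducible f" and lead: "lead_coeff f = 1" and even: "even (degree f)"
    and "a \<noteq> 0" and red: "\<not> irreducible (f \<circ>\<^sub>p [:d, h, a:])"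
  obtains e b E H where "e \<noteq> 0" "f = E\<^sup>2 - smult e ([:- b, 1:] * H\<^sup>2)"
    "lead_coeff E = 1" "2 * degree E = degree f" "degree H < degree E"
proof -
  have "degree f > 0"
    using irr by (metis irreducible_def is_unit_iff_degree neq0_conv)
  with even have deg: "degree f > 1" by presburger
  \<comment> \<open>The value of the quadratic at its vertex.\<close>
  define b where "b = d - h\<^sup>2 / (4 * a)"
  define F where "F = f \<circ>\<^sub>p [:b, a:]"
  have irrF: "irreducible F" unfolding F_def by (rule irreducible_pcompose_linear) fact+
  have degF: "degree F = degree f" using \<open>a \<noteq> 0\<close> by (simp add: F_def degree_pcompose)
  have "[:d, h, a:] = [:b, a:] \<circ>\<^sub>p ([:0, 0, 1:] \<circ>\<^sub>p [:h / (2 * a), 1:])"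
    using \<open>a \<noteq> 0\<close> by (simp add: pcompose_pCons b_def field_simps power2_eq_square)
  then have "f \<circ>\<^sub>p [:d, h, a:] = (F \<circ>\<^sub>p [:0, 0, 1:]) \<circ>\<^sub>p [:h / (2 * a), 1:]"
    by (simp add: F_def flip: pcompose_assoc)
  with red have "\<not> irreducible (F \<circ>\<^sub>p [:0, 0, 1:])"
    by (metis irreducible_pcompose_linear zero_neq_one)
  then obtain k E1 H1 where k: "k \<noteq> 0" and F: "F = smult k (E1\<^sup>2 - [:0, 1:] * H1\<^sup>2)"
    using reducible_pcompose_square irrF deg degF by metis
  define M where "M = [:- b / a, 1 / a:]"
  define E2 H2 where "E2 = E1 \<circ>\<^sub>p M" "H2 = H1 \<circ>\<^sub>p M"
  have "[:b, a:] \<circ>\<^sub>p M = [:0, 1:]" using \<open>a \<noteq> 0\<close> by (simp add: M_def pcompose_pCons)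
  then have "f = F \<circ>\<^sub>p M" by (simp add: F_def flip: pcompose_assoc)
  then have f: "f = smult k (E2\<^sup>2 - M * H2\<^sup>2)"
    unfolding F E2_H2_def
    by (simp add: pcompose_smult pcompose_diff pcompose_mult power2_eq_square pcompose_pCons)
  have degN: "degree (E2\<^sup>2 - M * H2\<^sup>2) = degree f" using k by (simp add: f)
  have degM: "degree M = 1" using \<open>a \<noteq> 0\<close> by (simp add: M_def)
  \<comment> \<open>The two degrees have different parity, so leading terms cannot cancel; as
    \<open>degree f\<close> is even, \<open>E2^2\<close> dominates.\<close>
  have less: "degree (M * H2\<^sup>2) < degree (E2\<^sup>2) \<and> degree H2 < degree E2"
  proof (cases "H2 = 0")
    case True
    moreover have "degree E2 > 0"
      using True degN \<open>degree f > 0\<close> degree_power_le[of E2 2] by (auto intro!: gr0I)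
    ultimately show ?thesis using degN \<open>degree f > 0\<close> by simp
  next
    case False
    with degM have d1: "degree (M * H2\<^sup>2) = 1 + 2 * degree H2"
      by (subst degree_mult_eq) (auto simp: degree_power_eq)
    have d2: "degree (E2\<^sup>2) = 2 * degree E2"
      by (cases "E2 = 0") (auto simp: degree_power_eq)
    have "\<not> degree (E2\<^sup>2) < degree (M * H2\<^sup>2)"
    proof
      assume "degree (E2\<^sup>2) < degree (M * H2\<^sup>2)"
      then have "degree f = 1 + 2 * degree H2"
        using d1 degN degree_add_eq_right[of "E2\<^sup>2" "- (M * H2\<^sup>2)"] by simp
      with even show False by simp
    qed
    moreover have "degree (E2\<^sup>2) \<noteq> degree (M * H2\<^sup>2)"
      unfolding d1 d2 by presburger
    ultimately show ?thesis using d1 d2 by linarith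
  qed
  then have degE2: "degree (E2\<^sup>2) = degree f"
    using degN degree_add_eq_left[of "- (M * H2\<^sup>2)" "E2\<^sup>2"] by simp
  have "lead_coeff (E2\<^sup>2 - M * H2\<^sup>2) = lead_coeff (E2\<^sup>2)"
    unfolding degN degE2 using less by (simp add: coeff_eq_0 degE2)
  moreover have "lead_coeff f = k * lead_coeff (E2\<^sup>2 - M * H2\<^sup>2)"
    using f lead_coeff_smult by metis
  ultimately have l: "k * (lead_coeff E2)\<^sup>2 = 1"
    using lead lead_coeff_power[of E2 2] by metis
  have degE: "2 * degree E2 = degree f"
    unfolding degE2[symmetric] by (cases "E2 = 0") (auto simp: degree_power_eq)
  define l0 where "l0 = lead_coeff E2"
  have "l0 \<noteq> 0" using l by (auto simp: l0_def)
  then have l0: "l0 \<noteq> 0" "k = 1 / l0\<^sup>2" using l unfolding l0_def by (simp_all add: nonzero_eq_divide_eq)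
  \<comment> \<open>Since \<open>k * l0^2 = 1\<close>, dividing by \<open>l0\<close> makes
    \<open>E\<close> monic and absorbs \<open>k\<close> into the square.\<close>
  define E where "E = smult (1 / l0) E2"
  show thesis
  proof (rule that[of "k / a" E b H2])
    show "k / a \<noteq> 0" using k \<open>a \<noteq> 0\<close> by simp
    have "M = smult (1 / a) [:- b, 1:]" by (simp add: M_def)
    then have "smult (k / a) ([:- b, 1:] * H2\<^sup>2) = smult k (M * H2\<^sup>2)"
      by (simp only: mult_smult_left smult_smult times_divide_eq_right mult_1_right)
    moreover have "E\<^sup>2 = smult k (E2\<^sup>2)"
      using l0 by (simp add: E_def power2_eq_square)
    ultimately show "f = E\<^sup>2 - smult (k / a) ([:- b, 1:] * H2\<^sup>2)"
      using f by (simp add: smult_diff_right)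
    show "lead_coeff E = 1" "2 * degree E = degree f" "degree H2 < degree E"
      using l0 degE less by (auto simp: E_def l0_def)
  qed
qed

section \<open>From the representation of \<open>x^4 + c\<close> to a rational square\<close>

lemma quartic_eq: "quartic c = [:of_int c, 0, 0, 0, 1:]"
  by (simp add: quartic_def monom_altdef numeral_eq_Suc one_pCons)

lemma degree_le_1E:
  assumes "degree p \<le> 1"
  obtains a b where "p = [:b, a:]"
proof
  show "p = [:coeff p 0, coeff p 1:]"
    using assms by (auto simp: poly_eq_iff coeff_pCons coeff_eq_0 split: nat.splits)
qed

lemma degree_le_2E:
  assumes "degree p \<le> 2"
  obtains a b c where "p = [:c, b, a:]"
proof
  show "p = [:coeff p 0, coeff p 1, coeff p 2:]"
    using assms by (auto simp: poly_eq_iff coeff_pCons coeff_eq_0 numeral_2_eq_2 split: nat.splits)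
qed

text \<open>The hypotheses compare coefficients in \<open>x^4 + c = E^2 - a * (x - b) * H^2\<close>
  with \<open>E = [:v, u, 1:]\<close> and \<open>H = [:q, p:]\<close>. At the root
  \<open>- r\<close> of \<open>H\<close> the right side is the square
  \<open>E(-r)^2\<close>.\<close>

lemma quartic_coefficients_imp_square:
  fixes a b c p q u v :: rat
  assumes "a \<noteq> 0" "c \<noteq> 0"
    and c0: "v\<^sup>2 + a * b * q\<^sup>2 = c"
    and c1: "2 * u * v = a * (q\<^sup>2 - 2 * b * q * p)"
    and c2: "u\<^sup>2 + 2 * v = a * (2 * q * p - b * p\<^sup>2)"
    and c3: "2 * u = a * p\<^sup>2"
  shows "\<exists>r s. r \<noteq> 0 \<and> r ^ 4 + c = s\<^sup>2"
proof -
  \<comment> \<open>A constant \<open>H\<close> would force \<open>u\<close>, \<open>v\<close> and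
    \<open>q\<close> to vanish, and with them \<open>c\<close>.\<close>
  have "p \<noteq> 0"
  proof
    assume "p = 0"
    with c3 c2 have "u = 0" "v = 0" by auto
    with c1 \<open>p = 0\<close> \<open>a \<noteq> 0\<close> have "q = 0" by simp
    with c0 \<open>v = 0\<close> \<open>c \<noteq> 0\<close> show False by simp
  qed
  define r where "r = q / p"
  have q: "q = r * p" using \<open>p \<noteq> 0\<close> by (simp add: r_def)
  have "u \<noteq> 0" using c3 \<open>p \<noteq> 0\<close> \<open>a \<noteq> 0\<close> by auto
  have "2 * u * v = (a * p\<^sup>2) * (r\<^sup>2 - 2 * b * r)"
    unfolding c1 q by (simp add: algebra_simps power2_eq_square)
  then have v: "v = r\<^sup>2 - 2 * b * r" using \<open>u \<noteq> 0\<close> by (simp flip: c3)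
  have "u\<^sup>2 + 2 * v = (a * p\<^sup>2) * (2 * r - b)"
    unfolding c2 q by (simp add: algebra_simps power2_eq_square)
  then have e2: "u\<^sup>2 + 2 * v = 2 * u * (2 * r - b)" by (simp flip: c3)
  have "c = v\<^sup>2 + (a * p\<^sup>2) * b * r\<^sup>2"
    unfolding q c0[symmetric] by (simp add: algebra_simps power2_eq_square)
  then have c: "c = v\<^sup>2 + 2 * u * b * r\<^sup>2" by (simp flip: c3)
  have "r \<noteq> 0" using c v \<open>c \<noteq> 0\<close> by auto
  \<comment> \<open>Once \<open>v\<close> is eliminated, the equation \<open>c2\<close> is linear in
    \<open>b\<close>.\<close>
  have b: "2 * b * (2 * r - u) = u\<^sup>2 + 2 * r\<^sup>2 - 4 * u * r"
    using e2 v by (simp add: algebra_simps)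
  have w: "2 * r - u \<noteq> 0"
  proof
    assume "2 * r - u = 0"
    then have "u = 2 * r" by simp
    with b have "r\<^sup>2 = 0" by (simp add: power2_eq_square)
    with \<open>r \<noteq> 0\<close> show False by simp
  qed
  \<comment> \<open>Eliminating \<open>b\<close> brings \<open>E(-r) = r^2 - u * r + v\<close> to
    the form \<open>2 * r ^ 3 / (2 * r - u)\<close>.\<close>
  have "(r ^ 4 + c) * (2 * r - u)\<^sup>2 = (2 * r ^ 3)\<^sup>2"
    using b unfolding c v by algebra
  then have "r ^ 4 + c = (2 * r ^ 3 / (2 * r - u))\<^sup>2"
    using w by (simp add: field_simps)
  with \<open>r \<noteq> 0\<close> show ?thesis by blast
qed

lemma superirreducible_quartic:
  assumes irr: "irreducible (quartic c)" and "c \<noteq> 0"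
    and no: "\<And>r s :: rat. r \<noteq> 0 \<Longrightarrow> r ^ 4 + of_int c \<noteq> s\<^sup>2"
  shows "superirreducible 2 (quartic c)"
  unfolding superirreducible_def
proof (intro conjI irr allI impI)
  fix g :: "rat poly"
  assume g: "0 < degree g \<and> degree g \<le> 2"
  then obtain a h d where gq: "g = [:d, h, a:]" using degree_le_2E by blast
  show "irreducible (quartic c \<circ>\<^sub>p g)"
  proof (cases "a = 0")
    case True
    with g gq have "h \<noteq> 0" by auto
    with True gq irr irreducible_pcompose_linear show ?thesis by auto
  next
    case False
    have lead: "lead_coeff (quartic c) = 1" and even: "even (degree (quartic c))"
      by (simp_all add: quartic_eq)
    show ?thesis
    proof (rule ccontr)
      assume "\<not> irreducible (quartic c \<circ>\<^sub>p g)"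
      then obtain e b E H where "e \<noteq> 0" and f: "quartic c = E\<^sup>2 - smult e ([:- b, 1:] * H\<^sup>2)"
        and E: "lead_coeff E = 1" "2 * degree E = degree (quartic c)" and H: "degree H < degree E"
        using reducible_pcompose_quadratic[of "quartic c" a d h] irr False lead even
        unfolding gq by metis
      have degE: "degree E = 2" using E by (simp add: quartic_eq)
      then obtain u v where Eq: "E = [:v, u, 1:]"
        using degree_le_2E[of E] E(1) by (metis coeff_pCons_Suc coeff_pCons_0 numeral_2_eq_2 order_refl)
      have "degree H \<le> 1" using degE H by simp
      then obtain p q where Hq: "H = [:q, p:]" using degree_le_1E by blast
      have "\<exists>r s. r \<noteq> 0 \<and> r ^ 4 + of_int c = (s::rat)\<^sup>2"
        by (rule quartic_coefficients_imp_square[of e _ v b q u p])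
           (use f \<open>e \<noteq> 0\<close> \<open>c \<noteq> 0\<close> in \<open>auto simp: quartic_eq Eq Hq power2_eq_square algebra_simps\<close>)
      with no show False by blast
    qed
  qed
qed

section \<open>Rational points and the theorem\<close>

lemma rat_square_int_imp_int:
  fixes t :: rat
  assumes "t\<^sup>2 = of_int k"
  obtains m where "t = of_int m" "m\<^sup>2 = k"
proof -
  obtain m e where q: "quotient_of t = (m, e)" by fastforce
  then have e: "e > 0" "coprime m e" "t = of_int m / of_int e"
    by (auto simp: quotient_of_denom_pos quotient_of_coprime quotient_of_div)
  have "(of_int m)\<^sup>2 = of_int k * (of_int e :: rat)\<^sup>2"
    using assms e(1,3) by (simp add: power_divide field_simps)
  then have "of_int (m\<^sup>2) = (of_int (k * e\<^sup>2) :: rat)" by simp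
  then have m: "m\<^sup>2 = k * e\<^sup>2" by (simp only: of_int_eq_iff)
  then have "e\<^sup>2 dvd m\<^sup>2" by simp
  moreover have "coprime (e\<^sup>2) (m\<^sup>2)" using e(2) by (simp add: coprime_commute)
  ultimately have "is_unit (e\<^sup>2)" using coprime_common_divisor[of "e\<^sup>2" "m\<^sup>2" "e\<^sup>2"] by simp
  then have "e dvd 1" by (metis dvd_mult_left power2_eq_square)
  then have "e = 1" using e(1) by simp
  with e m that show thesis by simp
qed

text \<open>After multiplication by the fourth power of the denominator \<open>e\<close> of
  \<open>r\<close>, the rational \<open>s * e^2\<close> has an integer square and so is an
  integer.\<close>

lemma rat_quartic_square_imp_nat:
  fixes r s :: rat
  assumes "r \<noteq> 0" and eq: "r ^ 4 + of_int c = s\<^sup>2"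
  obtains x y z :: nat where "coprime x z" "x > 0" "z > 0" "int x ^ 4 + c * int z ^ 4 = (int y)\<^sup>2"
proof -
  obtain m e where q: "quotient_of r = (m, e)" by fastforce
  then have e: "e > 0" "coprime m e" "r = of_int m / of_int e"
    by (auto simp: quotient_of_denom_pos quotient_of_coprime quotient_of_div)
  have "(s * (of_int e)\<^sup>2)\<^sup>2 = (r ^ 4 + of_int c) * of_int e ^ 4"
    by (simp add: eq power_mult_distrib)
  also have "\<dots> = (r * of_int e) ^ 4 + of_int c * of_int e ^ 4"
    by (simp add: power_mult_distrib distrib_right)
  also have "\<dots> = of_int (m ^ 4 + c * e ^ 4)"
    using e(1) by (simp add: e(3))
  finally obtain n where n: "n\<^sup>2 = m ^ 4 + c * e ^ 4" by (rule rat_square_int_imp_int)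
  show thesis
  proof (rule that)
    show "coprime (nat \<bar>m\<bar>) (nat \<bar>e\<bar>)" using e(2) by simp
    show "0 < nat \<bar>m\<bar>" "0 < nat \<bar>e\<bar>" using e \<open>r \<noteq> 0\<close> by auto
    show "int (nat \<bar>m\<bar>) ^ 4 + c * int (nat \<bar>e\<bar>) ^ 4 = (int (nat \<bar>n\<bar>))\<^sup>2"
      using n by simp
  qed
qed

lemma superirreducible_quartic_nat:
  assumes "irreducible (quartic c)" "c \<noteq> 0"
    and no: "\<And>x y z :: nat. coprime x z \<Longrightarrow> x > 0 \<Longrightarrow> z > 0 \<Longrightarrow> int x ^ 4 + c * int z ^ 4 \<noteq> (int y)\<^sup>2"
  shows "superirreducible 2 (quartic c)"
proof (rule superirreducible_quartic[OF assms(1,2)])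
  fix r s :: rat assume "r \<noteq> 0"
  then show "r ^ 4 + of_int c \<noteq> s\<^sup>2"
    using rat_quartic_square_imp_nat[of r c s] no by metis
qed

text \<open>Positive constants keep the equation within the naturals, where the descents are
  stated.\<close>

lemma superirreducible_quartic_of_nat:
  fixes k :: nat
  assumes "irreducible (quartic (int k))" "k > 0"
    and no: "\<And>x y z :: nat. coprime x z \<Longrightarrow> x > 0 \<Longrightarrow> z > 0 \<Longrightarrow> x ^ 4 + k * z ^ 4 \<noteq> y\<^sup>2"
  shows "superirreducible 2 (quartic (int k))"
proof (rule superirreducible_quartic_nat[OF assms(1)])
  fix x y z :: nat
  assume "coprime x z" "x > 0" "z > 0"
  then have "int (x ^ 4 + k * z ^ 4) \<noteq> int (y\<^sup>2)"
    using no[of x z y] by (simp only: of_nat_eq_iff not_False_eq_True)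
  then show "int x ^ 4 + int k * int z ^ 4 \<noteq> (int y)\<^sup>2" by simp
qed (use assms in simp)

section \<open>Irreducibility of \<open>x^4 + 1\<close> and \<open>x^4 + 2\<close>\<close>

text \<open>A root would make \<open>- c\<close> a square. In a product of monic quadratics the
  linear coefficients are \<open>u\<close> and \<open>- u\<close>, and
  \<open>u * (v' - v) = 0\<close>: either \<open>u = 0\<close> and \<open>v^2 = - c\<close>, or
  \<open>v' = v\<close>, \<open>v^2 = c\<close> and \<open>u^2 = 2 * v\<close>.\<close>

lemma irreducible_quartic:
  assumes neg: "\<And>t :: rat. t\<^sup>2 \<noteq> - of_int c"
    and sq: "\<And>u v :: rat. v\<^sup>2 = of_int c \<Longrightarrow> u\<^sup>2 \<noteq> 2 * v"
  shows "irreducible (quartic c)"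
proof (rule irreducibleI)
  show nz: "quartic c \<noteq> 0" by (simp add: quartic_eq)
  show "\<not> is_unit (quartic c)" using nz by (simp add: is_unit_iff_degree) (simp add: quartic_eq)
  fix A B assume AB: "quartic c = A * B"
  with nz have "A \<noteq> 0" "B \<noteq> 0" by auto
  have degs: "degree A + degree B = 4"
    using \<open>A \<noteq> 0\<close> \<open>B \<noteq> 0\<close> by (simp add: quartic_eq flip: AB degree_mult_eq)
  have noroot: "degree C \<noteq> 1" if "C dvd quartic c" for C
  proof
    assume "degree C = 1"
    then have "degree C \<le> 1" by simp
    then obtain b a where C: "C = [:b, a:]" using degree_le_1E by blast
    with \<open>degree C = 1\<close> have "a \<noteq> 0" by auto
    then have "poly C (- b / a) = 0" by (simp add: C)
    then have "poly (quartic c) (- b / a) = 0" using that by (metis dvdE mult_eq_0_iff poly_mult)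
    then have "(- b / a) ^ 4 = - of_int c" by (simp add: quartic_eq power4_eq_xxxx algebra_simps eq_neg_iff_add_eq_0)
    then have "((- b / a)\<^sup>2)\<^sup>2 = - of_int c" by simp
    with neg show False by blast
  qed
  have "degree A \<noteq> 1" "degree B \<noteq> 1" using AB noroot by auto
  show "is_unit A \<or> is_unit B"
  proof (rule ccontr)
    assume "\<not> (is_unit A \<or> is_unit B)"
    then have "degree A \<noteq> 0" "degree B \<noteq> 0" using \<open>A \<noteq> 0\<close> \<open>B \<noteq> 0\<close> by (auto simp: is_unit_iff_degree)
    with degs \<open>degree A \<noteq> 1\<close> \<open>degree B \<noteq> 1\<close> have d2: "degree A \<le> 2" "degree B \<le> 2" by linarith+
    obtain a0 a1 a2 where A: "A = [:a0, a1, a2:]" using degree_le_2E[OF d2(1)] by blast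
    obtain b0 b1 b2 where B: "B = [:b0, b1, b2:]" using degree_le_2E[OF d2(2)] by blast
    have e: "a2 * b2 = 1" "a1 * b2 + a2 * b1 = 0" "a0 * b2 + a1 * b1 + a2 * b0 = 0"
        "a0 * b1 + a1 * b0 = 0" "a0 * b0 = of_int c"
      using AB by (auto simp: quartic_eq A B algebra_simps)
    \<comment> \<open>As \<open>a2 * b2 = 1\<close>, multiplying \<open>A\<close> by
      \<open>b2\<close> and \<open>B\<close> by \<open>a2\<close> makes both factors monic.\<close>
    define u v where "u = a1 * b2" "v = a0 * b2"
    define u' v' where "u' = b1 * a2" "v' = b0 * a2"
    note d = u_v_def u'_v'_def
    have 1: "u' = - u" using e(2) by (simp add: d algebra_simps eq_neg_iff_add_eq_0)
    have 2: "v + u * u' + v' = 0" using e(1,3) unfolding d by algebra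
    have 3: "v * u' + u * v' = 0" using e(1,4) unfolding d by algebra
    have 4: "v * v' = of_int c" using e(1,5) unfolding d by algebra
    have "u * (v' - v) = 0" using 1 3 by (simp add: algebra_simps)
    then have "u = 0 \<or> v' = v" by simp
    then show False
    proof
      assume "u = 0"
      then have "v' = - v" using 2 by (simp add: eq_neg_iff_add_eq_0 add.commute)
      then have "v\<^sup>2 = - of_int c" using 4 by (simp add: power2_eq_square flip: 4)
      with neg show False by blast
    next
      assume "v' = v"
      then have "v\<^sup>2 = of_int c" "u\<^sup>2 = 2 * v" using 1 2 4 by (simp_all add: power2_eq_square)
      with sq show False by blast
    qed
  qed
qed

lemma int_square_neq_two: "(m :: int)\<^sup>2 \<noteq> 2"
proof
  assume m: "m\<^sup>2 = 2"
  then have "\<bar>m\<bar>\<^sup>2 < 2\<^sup>2" by simp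
  then have "\<bar>m\<bar> < 2" by (rule power2_less_imp_less) simp
  then have "m \<in> {-1, 0, 1}" by auto
  with m show False by auto
qed

lemma rat_square_neq_two: "(t :: rat)\<^sup>2 \<noteq> 2"
  using rat_square_int_imp_int[of t 2] int_square_neq_two by auto

lemma irreducible_quartic_1: "irreducible (quartic 1)"
proof (rule irreducible_quartic)
  show "t\<^sup>2 \<noteq> - of_int 1" for t :: rat
    using zero_le_power2[of t] by linarith
  fix u v :: rat assume "v\<^sup>2 = of_int 1"
  then have "v = 1 \<or> v = -1" by (simp add: power2_eq_1_iff)
  then show "u\<^sup>2 \<noteq> 2 * v"
  proof
    assume "v = 1"
    then show ?thesis using rat_square_neq_two by simp
  next
    assume "v = -1"
    then show ?thesis using zero_le_power2[of u] by linarith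
  qed
qed

lemma irreducible_quartic_2: "irreducible (quartic 2)"
proof (rule irreducible_quartic)
  show "t\<^sup>2 \<noteq> - of_int 2" for t :: rat
    using zero_le_power2[of t] by linarith
  show "u\<^sup>2 \<noteq> 2 * v" if "v\<^sup>2 = of_int 2" for u v :: rat
    using that rat_square_neq_two[of v] by simp
qed

text \<open>Two odd numbers give 2 modulo 16, not a square; otherwise symmetry puts the even one in
  the place of \<open>z\<close>. Positivity of \<open>x\<close> excludes
  \<open>0 ^ 4 + 1 ^ 4 = 1\<close>.\<close>

lemma no_square_one:
  fixes x y z :: nat
  assumes "coprime x z" "x > 0" "z > 0"
  shows "x ^ 4 + z ^ 4 \<noteq> y\<^sup>2"
proof (cases "even x \<or> even z")
  case True
  then show ?thesis
    using no_square_one_even[of x z y] no_square_one_even[of z x y] assms by (metis add.commute coprime_commute)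
next
  case False
  then have "1 * y\<^sup>2 \<noteq> 1 * x ^ 4 + 1 * z ^ 4"
    by (intro square_neq_quartic[of _ "{1}" _ _ "{1}"]) auto
  then show ?thesis by simp
qed

lemma int_cong_nat_mod:
  assumes "[int p = k] (mod int m)"
  shows "p mod m = nat (k mod int m)"
  using assms unfolding cong_def by (metis nat_int zmod_int)

theorem theorem1p3:
  shows "(superirreducible 2 (quartic 1) \<and> superirreducible 2 (quartic 2)) \<and>
    (\<forall>f \<in> {quartic (int p) | p::nat. prime p \<and> ([int p = 7] (mod 16) \<or> [int p = 11] (mod 16))}.
        irreducible f \<longrightarrow> superirreducible 2 f) \<and>
    (\<forall>f \<in> {quartic (2 * int p) | p::nat. prime p \<and> ([int p = 3] (mod 8) \<or> [int p = - 3] (mod 8))}.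
        irreducible f \<longrightarrow> superirreducible 2 f) \<and>
    (\<forall>f \<in> {quartic (4 * int p) | p::nat. prime p \<and>
                ([int p = 3] (mod 16) \<or> [int p = - 3] (mod 16) \<or> [int p = - 5] (mod 16))}
           \<union> {quartic (- int p) | p::nat. prime p \<and>
                ([int p = 3] (mod 16) \<or> [int p = - 3] (mod 16) \<or> [int p = - 5] (mod 16))}.
        irreducible f \<longrightarrow> superirreducible 2 f)"
proof -
  have "superirreducible 2 (quartic (int 1))" "superirreducible 2 (quartic (int 2))"
    using superirreducible_quartic_of_nat[of 1] superirreducible_quartic_of_nat[of 2]
      irreducible_quartic_1 irreducible_quartic_2 no_square_one no_square_two by simp_all
  then have part_a: "superirreducible 2 (quartic 1)" "superirreducible 2 (quartic 2)" by simp_all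
  have part_i: "superirreducible 2 (quartic (int p))"
    if "prime p" "[int p = 7] (mod 16) \<or> [int p = 11] (mod 16)" "irreducible (quartic (int p))" for p :: nat
  proof (rule superirreducible_quartic_of_nat[OF that(3)])
    have "p mod 16 = 7 \<or> p mod 16 = 11" using that(2) int_cong_nat_mod[of p _ 16] by force
    then show "x ^ 4 + p * z ^ 4 \<noteq> y\<^sup>2" if "coprime x z" "z > 0" for x y z
      using no_square_prime[OF \<open>prime p\<close> _ that] by blast
  qed (use \<open>prime p\<close> prime_gt_0_nat in blast)
  have part_ii: "superirreducible 2 (quartic (2 * int p))"
    if "prime p" "[int p = 3] (mod 8) \<or> [int p = - 3] (mod 8)" "irreducible (quartic (2 * int p))" for p :: nat
  proof -
    have "p mod 8 = 3 \<or> p mod 8 = 5" using that(2) int_cong_nat_mod[of p _ 8] by force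
    then have "superirreducible 2 (quartic (int (2 * p)))"
      using no_square_two_prime[OF \<open>prime p\<close>] that(3) prime_gt_0_nat[OF that(1)]
      by (intro superirreducible_quartic_of_nat) simp_all
    then show ?thesis by simp
  qed
  \<comment> \<open>The classes of -3 and -5 are 13 and 11.\<close>
  have mod16: "p mod 16 \<in> {3, 11, 13}"
    if "[int p = 3] (mod 16) \<or> [int p = - 3] (mod 16) \<or> [int p = - 5] (mod 16)" for p :: nat
    using that int_cong_nat_mod[of p _ 16] by force
  have part_iii: "superirreducible 2 (quartic (4 * int p))"
    if "prime p" "[int p = 3] (mod 16) \<or> [int p = - 3] (mod 16) \<or> [int p = - 5] (mod 16)"
      "irreducible (quartic (4 * int p))" for p :: nat
  proof -
    have "superirreducible 2 (quartic (int (4 * p)))"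
      using no_square_four_prime[OF \<open>prime p\<close> mod16[OF that(2)]] that(3) prime_gt_0_nat[OF that(1)]
      by (intro superirreducible_quartic_of_nat) simp_all
    then show ?thesis by simp
  qed
  have part_iv: "superirreducible 2 (quartic (- int p))"
    if "prime p" "[int p = 3] (mod 16) \<or> [int p = - 3] (mod 16) \<or> [int p = - 5] (mod 16)"
      "irreducible (quartic (- int p))" for p :: nat
  proof (rule superirreducible_quartic_nat[OF that(3)])
    show "- int p \<noteq> 0" using prime_gt_0_nat[OF that(1)] by simp
    fix x y z :: nat
    assume "coprime x z" "z > 0"
    then have "int (y\<^sup>2 + p * z ^ 4) \<noteq> int (x ^ 4)"
      using no_square_minus_prime[OF \<open>prime p\<close> mod16[OF that(2)]] by (simp only: of_nat_eq_iff not_False_eq_True)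
    then show "int x ^ 4 + - int p * int z ^ 4 \<noteq> (int y)\<^sup>2" by (simp add: algebra_simps)
  qed
  show ?thesis using part_a part_i part_ii part_iii part_iv by blast
qed

end
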